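(* Let $n\ge2$, $\gamma\in\mathbb{C}\setminus\{0\}$, and let $A^\infty_{12}(\lambda),B^\infty_{12}(\lambda),C^\infty_{12}(\lambda),D^\infty_{12}(\lambda)$ be the rational constant Arutyunov-Chekhov-Frolov matrices defined in the context. Define the $n\times n$ matrix $b^\infty(\lambda)$ and the $n^2\times n^2$ matrix $R^\infty$ by $$b^\infty_{ij}(\lambda)=\frac{\lambda_j^{\,i-1}}{\prod_{a\neq j}\lambda_{ja}},\qquad i,j=1,\dots,n,$$ $$R^\infty_{12}=\sum_{i,j=1}^n e_{ii}\otimes e_{jj}+\gamma\sum_{i=1}^n\sum_{k=1}^{i-1}\sum_{j=1}^{i-k}\left(e_{i,i-k}\otimes e_{j,j+k-1}-e_{j,j+k-1}\otimes e_{i,i-k}\right).$$ Then, writing $b=b^\infty$: 1. $B^\infty_{12}=C^\infty_{21}=b_2^{-1}\,b_2(\lambda+\gamma h_1)$. 2. $A^\infty_{12}=b_1^{-1}b_2^{-1}\,R^\infty_{12}\,b_1b_2$, and $R^\infty$ (which does not depend on $\lambda$) satisfies the Yang-Baxter equation $R^\infty_{12}R^\infty_{13}R^\infty_{23}=R^\infty_{23}R^\infty_{13}R^\infty_{12}$. 3. $D^\infty_{12}=b_1^{-1}(\lambda+\gamma h_2)\,b_2^{-1}\,R^\infty_{12}\,b_1\,b_2(\lambda+\gamma h_1)$. 4. Let $f=f(\lambda)$ be $\gamma$-periodic in each $\lambda_i$. The matrix $K_{ij}=(f-\Lambda_{ij})\prod_{a\ne j}\frac{\gamma}{\lambda_{ja}}$,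 $\Lambda_{ij}=\sum_a\lambda_a-(\lambda_i+\lambda_j)$, equals $b^{-1}Q\,b$ with $Q=\gamma^{n-1}(f\,e_{n1}+e_{n-1,1}+e_{n2})$; and the matrix $K_{ij}=\frac{f}{f-\lambda_{ij}}\prod_{a\neq j}\left(1+\frac{f}{\lambda_{ja}}\right)$ (with $f\not\equiv 0$) equals $b^{-1}Q\,b$ with $Q=1+\sum_{i>j}\binom{i-1}{i-j}f^{\,i-j}\,e_{ij}$.
   Context: Notation: $\lambda=(\lambda_1,\dots,\lambda_n)$ are complex variables, $\lambda_{ij}=\lambda_i-\lambda_j$; $e_{ij}$ are the standard $n\times n$ matrix units, $h_j=e_{jj}$. For an $n\times n$ matrix $M(\lambda)$: $M_1=M\otimes1$, $M_2=1\otimes M$, $M_2(\lambda+\gamma h_1)=\sum_j e_{jj}\otimes M(\lambda+\gamma\varepsilon_j)$, $M_1(\lambda+\gamma h_2)=\sum_j M(\lambda+\gamma\varepsilon_j)\otimes e_{jj}$, where $\lambda+\gamma\varepsilon_j$ is $\lambda$ with $\lambda_j$ replaced by $\lambda_j+\gamma$; $M^{-1}_1(\lambda+\gamma h_2)$ is the same with $M^{-1}$ in place of $M$. For a matrix $M_{12}=\sum a\otimes b$, $M_{21}=\sum b\otimes a$. Identities hold as identities of meromorphic functions of $\lambda$. The rational constant ACF matrices are $$A^\infty_{12}=1\otimes1+\sum_{i\neq j}\frac{\gamma}{\lambda_{ij}}(e_{ii}-e_{ij})\otimes(e_{jj}-e_{ji}),$$ $$B^\infty_{12}=1\otimes1+\sum_{i\neq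 j}\frac{\gamma}{\lambda_{ij}-\gamma}\,e_{jj}\otimes(e_{ii}-e_{ij}),\qquad C^\infty_{12}=B^\infty_{21},$$ $$D^\infty_{12}=1\otimes1+\sum_{i\neq j}\frac{\gamma}{\lambda_{ij}}(e_{ij}\otimes e_{ji}-e_{ii}\otimes e_{jj}).$$ The matrices $K$ in item 4 are known solutions of the constant semi-dynamical reflection equation $A^\infty_{12}K_1B^\infty_{12}K_2(\lambda+\gamma h_1)=K_2C^\infty_{12}K_1(\lambda+\gamma h_2)D^\infty_{12}$. *)

theory Defs
  imports "HOL-Analysis.Analysis"
begin

text \<open>
  A point \<open>(\<lambda>\<^sub>1, \<dots>, \<lambda>\<^sub>n)\<close> is a vector \<open>l :: 'n point\<close>, where \<open>n = CARD('n)\<close>. The linear order on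
  \<open>'n\<close> is only used to number the coordinates by \<open>1, \<dots>, n\<close>.
\<close>

type_synonym 'n point = "complex^'n"
type_synonym 'n matr = "complex^'n^'n"
type_synonym 'n matr2 = "complex^('n \<times> 'n)^('n \<times> 'n)"
type_synonym 'n matr3 = "complex^('n \<times> 'n \<times> 'n)^('n \<times> 'n \<times> 'n)"

section \<open>Meromorphic functions of several variables\<close>

definition holomorphic_fun_on :: "('n::finite point \<Rightarrow> complex) \<Rightarrow> 'n point set \<Rightarrow> bool" where
  "holomorphic_fun_on g U \<longleftrightarrow>
     (\<forall>l\<in>U. \<exists>D. (g has_derivative D) (at l) \<and> (\<forall>c v. D (c *s v) = c * D v))"

text \<open>
  Locally a quotient \<open>g / h\<close> of holomorphic functions, where \<open>h\<close> vanishes identically on no nonempty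
  open set. The values on the zero set of \<open>h\<close> are unconstrained, so that a meromorphic function is
  represented by a total function whose values at its poles and points of indeterminacy are
  irrelevant.
\<close>

definition meromorphic_fun :: "('n::finite point \<Rightarrow> complex) \<Rightarrow> bool" where
  "meromorphic_fun f \<longleftrightarrow>
     (\<forall>p. \<exists>U g h. open U \<and> p \<in> U \<and> holomorphic_fun_on g U \<and> holomorphic_fun_on h U \<and>
        (\<forall>V. open V \<and> V \<subseteq> U \<and> V \<noteq> {} \<longrightarrow> (\<exists>l\<in>V. h l \<noteq> 0)) \<and>
        (\<forall>l\<in>U. h l \<noteq> 0 \<longrightarrow> f l = g l / h l))"

text \<open>
  Equality as (scalar- or matrix-valued) meromorphic functions: the values agree on a dense open set.
  In particular the points where some denominator vanishes, at which division by zero yields an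
  artificial value, play no role.
\<close>

definition mero_eq :: "('n::finite point \<Rightarrow> 'a) \<Rightarrow> ('n point \<Rightarrow> 'a) \<Rightarrow> bool"  (infix "\<simeq>" 50) where
  "F \<simeq> G \<longleftrightarrow> (\<exists>U. open U \<and> closure U = UNIV \<and> (\<forall>l\<in>U. F l = G l))"

definition mero_periodic :: "complex \<Rightarrow> ('n::finite point \<Rightarrow> complex) \<Rightarrow> bool" where
  "mero_periodic \<gamma> f \<longleftrightarrow> (\<forall>i. (\<lambda>l. f (l + axis i \<gamma>)) \<simeq> f)"

section \<open>Matrices and tensor legs\<close>

definition pos :: "'n::{finite,linorder} \<Rightarrow> nat" where
  "pos i = card {j. j \<le> i}"

definition unit :: "'n::finite \<Rightarrow> 'n \<Rightarrow> 'n matr" where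
  "unit i j = (\<chi> r s. if r = i \<and> s = j then 1 else 0)"

text \<open>The matrix unit \<open>e\<^sub>p\<^sub>q\<close> addressed by numbers \<open>1 \<le> p, q \<le> n\<close>.\<close>

definition nunit :: "nat \<Rightarrow> nat \<Rightarrow> 'n::{finite,linorder} matr" where
  "nunit p q = (\<chi> r s. if pos r = p \<and> pos s = q then 1 else 0)"

definition smul :: "complex \<Rightarrow> complex^'m^'n \<Rightarrow> complex^'m^'n"  (infixr "\<cdot>" 75) where
  "c \<cdot> M = (\<chi> r s. c * M $ r $ s)"

definition tensor ::
  "'n::finite matr \<Rightarrow> 'n matr \<Rightarrow> 'n matr2"  (infixr "\<otimes>" 72) where
  "M \<otimes> N = (\<chi> r s. M $ fst r $ fst s * N $ snd r $ snd s)"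

definition flip :: "'n::finite matr2 \<Rightarrow> 'n matr2" where
  "flip M = (\<chi> r s. M $ (snd r, fst r) $ (snd s, fst s))"

definition leg1 :: "'n::finite matr \<Rightarrow> 'n matr2" where
  "leg1 M = M \<otimes> mat 1"

definition leg2 :: "'n::finite matr \<Rightarrow> 'n matr2" where
  "leg2 M = mat 1 \<otimes> M"

text \<open>\<open>M\<^sub>1(\<lambda> + \<gamma>h\<^sub>2)\<close> and \<open>M\<^sub>2(\<lambda> + \<gamma>h\<^sub>1)\<close>.\<close>

definition leg1_shift ::
  "complex \<Rightarrow> ('n::finite point \<Rightarrow> 'n matr) \<Rightarrow> 'n point \<Rightarrow> 'n matr2" where
  "leg1_shift \<gamma> M l = (\<Sum>j\<in>UNIV. M (l + axis j \<gamma>) \<otimes> unit j j)"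

definition leg2_shift ::
  "complex \<Rightarrow> ('n::finite point \<Rightarrow> 'n matr) \<Rightarrow> 'n point \<Rightarrow> 'n matr2" where
  "leg2_shift \<gamma> M l = (\<Sum>j\<in>UNIV. unit j j \<otimes> M (l + axis j \<gamma>))"

definition leg12 :: "'n::finite matr2 \<Rightarrow> 'n matr3" where
  "leg12 R = (\<chi> r s. case (r, s) of ((i, j, k), (i', j', k')) \<Rightarrow>
     if k = k' then R $ (i, j) $ (i', j') else 0)"

definition leg13 :: "'n::finite matr2 \<Rightarrow> 'n matr3" where
  "leg13 R = (\<chi> r s. case (r, s) of ((i, j, k), (i', j', k')) \<Rightarrow>
     if j = j' then R $ (i, k) $ (i', k') else 0)"

definition leg23 :: "'n::finite matr2 \<Rightarrow> 'n matr3" where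
  "leg23 R = (\<chi> r s. case (r, s) of ((i, j, k), (i', j', k')) \<Rightarrow>
     if i = i' then R $ (j, k) $ (j', k') else 0)"

section \<open>The rational constant Arutyunov-Chekhov-Frolov matrices\<close>

definition Ainf :: "complex \<Rightarrow> 'n::finite point \<Rightarrow> 'n matr2" where
  "Ainf \<gamma> l = mat 1 \<otimes> mat 1 +
     (\<Sum>(i, j)\<in>{(i, j). i \<noteq> j}.
        (\<gamma> / (l $ i - l $ j)) \<cdot> ((unit i i - unit i j) \<otimes> (unit j j - unit j i)))"

definition Binf :: "complex \<Rightarrow> 'n::finite point \<Rightarrow> 'n matr2" where
  "Binf \<gamma> l = mat 1 \<otimes> mat 1 +
     (\<Sum>(i, j)\<in>{(i, j). i \<noteq> j}.
        (\<gamma> / (l $ i - l $ j - \<gamma>)) \<cdot> (unit j j \<otimes> (unit i i - unit i j)))"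

definition Cinf :: "complex \<Rightarrow> 'n::finite point \<Rightarrow> 'n matr2" where
  "Cinf \<gamma> l = flip (Binf \<gamma> l)"

definition Dinf :: "complex \<Rightarrow> 'n::finite point \<Rightarrow> 'n matr2" where
  "Dinf \<gamma> l = mat 1 \<otimes> mat 1 +
     (\<Sum>(i, j)\<in>{(i, j). i \<noteq> j}.
        (\<gamma> / (l $ i - l $ j)) \<cdot> (unit i j \<otimes> unit j i - unit i i \<otimes> unit j j))"

section \<open>The twist and the constant R-matrix\<close>

definition binf :: "'n::{finite,linorder} point \<Rightarrow> 'n matr" where
  "binf l = (\<chi> i j. l $ j ^ (pos i - 1) / (\<Prod>a\<in>UNIV - {j}. l $ j - l $ a))"

definition Rinf :: "complex \<Rightarrow> 'n::{finite,linorder} matr2" where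
  "Rinf \<gamma> =
     (\<Sum>i\<in>UNIV. \<Sum>j\<in>UNIV. unit i i \<otimes> unit j j) +
     \<gamma> \<cdot> (\<Sum>i = 1..CARD('n). \<Sum>k = 1..i - 1. \<Sum>j = 1..i - k.
        nunit i (i - k) \<otimes> nunit j (j + k - 1) - nunit j (j + k - 1) \<otimes> nunit i (i - k))"

section \<open>The reflection matrices\<close>

definition K1 :: "complex \<Rightarrow> ('n::finite point \<Rightarrow> complex) \<Rightarrow> 'n point \<Rightarrow> 'n matr" where
  "K1 \<gamma> f l = (\<chi> i j.
     (f l - ((\<Sum>a\<in>UNIV. l $ a) - (l $ i + l $ j))) *
     (\<Prod>a\<in>UNIV - {j}. \<gamma> / (l $ j - l $ a)))"

definition Q1 ::
  "complex \<Rightarrow> ('n::{finite,linorder} point \<Rightarrow> complex) \<Rightarrow> 'n point \<Rightarrow> 'n matr" where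
  "Q1 \<gamma> f l = \<gamma> ^ (CARD('n) - 1) \<cdot>
     (f l \<cdot> nunit CARD('n) 1 + nunit (CARD('n) - 1) 1 + nunit CARD('n) 2)"

definition K2 :: "('n::finite point \<Rightarrow> complex) \<Rightarrow> 'n point \<Rightarrow> 'n matr" where
  "K2 f l = (\<chi> i j.
     f l / (f l - (l $ i - l $ j)) * (\<Prod>a\<in>UNIV - {j}. 1 + f l / (l $ j - l $ a)))"

definition Q2 :: "('n::{finite,linorder} point \<Rightarrow> complex) \<Rightarrow> 'n point \<Rightarrow> 'n matr" where
  "Q2 f l = mat 1 +
     (\<Sum>i = 1..CARD('n). \<Sum>j = 1..<i.
        (of_nat ((i - 1) choose (i - j)) * f l ^ (i - j)) \<cdot> nunit i j)"

end

(* Write phi(x) = (1, x, ..., x^(n-1)) for the moment vector and P_i(x) for the product of x - lambda_a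
   over a \<noteq> i. The j-th column of b is phi(lambda_j) / P_j(lambda_j), and the i-th row of its inverse
   consists of the coefficients of P_i, i.e. the i-th entry of b^(-1) phi(x) is P_i(x). The matrix R
   acts on moment vectors by a divided difference,
     R (phi(x) (x) phi(y)) = phi(x) (x) phi(y) + gamma (phi(x) (x) phi(y) - phi(y) (x) phi(x)) / (x - y),
   with a derivative in the limit x = y. Hence all twisted matrices can be read off from values
   of the P_i at the points lambda_j and lambda_j + gamma, and the Yang-Baxter equation is an identity
   between the six permutations of phi(x) (x) phi(y) (x) phi(z). For the second reflection matrix one
   also needs that f - lambda_ij vanishes on no open set, which follows from the identity
   theorem, since lambda_ij is not gamma-periodic for i \<noteq> j, and f itself is not 0. *)

theory Submission
  imports Defs "HOL-Complex_Analysis.Conformal_Mappings"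
begin

section \<open>Generic points\<close>

text \<open>Equality of meromorphic functions only asks for agreement on some dense open set, so
  each matrix identity is proved pointwise where all coordinates differ, and where needed also after
  every shift by \<open>\<gamma>\<close>. \<open>densely\<close> is the predicate form that lets
  such conditions be intersected. The divided difference comes from a geometric sum: for p > q the
  quotient (x^p y^q - y^p x^q)/(x - y) is a sum of p - q monomials, and these are exactly the terms
  that the triple sum in \<open>Rinf\<close> puts into one row. The shifts decide how equal column
  indices behave. In A both legs then sit at the same node, and the derivative enters. In D the
  arguments are x and x + \<open>\<gamma>\<close>, so that 1 + \<open>\<gamma>\<close>/(x - y) = 0
  and R acts there as a bare permutation. The delicate point on the analytic side is that a
  meromorphic function is a total function with arbitrary values where a local denominator vanishes,
  so its set of zeros is neither closed nor open; the connectedness argument has to work with a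
  regularised set.\<close>

definition densely :: "('a::topological_space \<Rightarrow> bool) \<Rightarrow> bool" where
  "densely P \<longleftrightarrow> (\<exists>U. open U \<and> closure U = UNIV \<and> (\<forall>l\<in>U. P l))"

lemma mero_eq_densely: "F \<simeq> G \<longleftrightarrow> densely (\<lambda>l. F l = G l)"
  by (simp add: mero_eq_def densely_def)

lemma densely_interior: "densely P \<longleftrightarrow> closure (interior {l. P l}) = UNIV"
proof
  assume "densely P"
  then obtain U where "open U" "closure U = UNIV" "\<forall>l\<in>U. P l" by (auto simp: densely_def)
  then have "U \<subseteq> interior {l. P l}" by (intro interior_maximal) auto
  with \<open>closure U = UNIV\<close> show "closure (interior {l. P l}) = UNIV"
    using closure_mono by blast
next
  assume "closure (interior {l. P l}) = UNIV"
  then show "densely P"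
    unfolding densely_def using interior_subset[of "{l. P l}"] by (intro exI[of _ "interior {l. P l}"]) auto
qed

lemma densely_True: "densely (\<lambda>_. True)"
  unfolding densely_def by (intro exI[of _ UNIV]) auto

lemma densely_mono: "densely P \<Longrightarrow> (\<And>l. P l \<Longrightarrow> Q l) \<Longrightarrow> densely Q"
  unfolding densely_def by meson

lemma densely_conj: 
  assumes "densely P" "densely Q"
  shows "densely (\<lambda>l. P l \<and> Q l)"
proof -
  from assms obtain U V where U: "open U" "closure U = UNIV" "\<forall>l\<in>U. P l"
    and V: "open V" "closure V = UNIV" "\<forall>l\<in>V. Q l" unfolding densely_def by meson
  have "closure (U \<inter> V) = closure U" by (rule closure_open_Int_superset) (use U V in auto)
  with U V show ?thesis unfolding densely_def by (intro exI[of _ "U \<inter> V"]) auto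
qed

lemma densely_all:
  assumes "\<And>i :: 'i::finite. densely (P i)"
  shows "densely (\<lambda>l. \<forall>i. P i l)"
proof -
  have "densely (\<lambda>l. \<forall>i\<in>I. P i l)" if "finite I" for I
    using that
  proof (induction I)
    case empty
    show ?case by (simp add: densely_True)
  next
    case (insert i I)
    with densely_conj[OF assms[of i] insert.IH] show ?case by simp
  qed
  from this[of UNIV] show ?thesis by simp
qed

lemma densely_ex: "densely P \<Longrightarrow> \<exists>l. P l"
  unfolding densely_def by (metis closure_empty UNIV_not_empty all_not_in_conv)

text \<open>Genericity is also required at the shifted points \<open>l + axis q \<gamma>\<close>,
  where the twist has to be regular as well.\<close>

lemma densely_translate:
  fixes v :: "'a::real_normed_vector"
  assumes "densely P"
  shows "densely (\<lambda>l. P (l + v))"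
proof -
  from assms obtain U where U: "open U" "closure U = UNIV" "\<forall>l\<in>U. P l"
    unfolding densely_def by meson
  have "closure ((+) (- v) ` U) = (+) (- v) ` closure U" by (rule closure_translation)
  also have "\<dots> = UNIV" unfolding U(2) by (rule surj_plus)
  finally show ?thesis
    unfolding densely_def using U open_translation[OF U(1), of "- v"]
    by (intro exI[of _ "(+) (- v) ` U"]) auto
qed

lemma norm_axis: "norm (axis i x :: 'a::real_normed_vector^'n::finite) = norm x"
proof -
  have "(\<Sum>j\<in>UNIV. (norm ((axis i x :: 'a^'n) $ j))\<^sup>2) = (norm x)\<^sup>2"
    by (simp add: axis_def if_distrib[of norm] if_distrib[of "\<lambda>t. t\<^sup>2"] cong: if_cong)
  then show ?thesis by (simp add: norm_vec_def L2_set_def)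
qed

text \<open>A point of the hyperplane is left by moving the single coordinate \<open>i\<close>,
  however little, since \<open>l $ j\<close> stays fixed.\<close>

lemma densely_coordinates_diff_ne:
  fixes c :: complex
  assumes "i \<noteq> j"
  shows "densely (\<lambda>l :: 'n::finite point. l $ i - l $ j \<noteq> c)"
  unfolding densely_def
proof (intro exI conjI)
  let ?U = "{l :: 'n point. l $ i - l $ j \<noteq> c}"
  show "open ?U" by (intro open_Collect_neq continuous_intros)
  show "closure ?U = UNIV"
  proof (rule UNIV_eq_I[symmetric])
    fix l :: "'n point"
    show "l \<in> closure ?U"
    proof (cases "l \<in> ?U")
      case True
      then show ?thesis by (rule subsetD[OF closure_subset])
    next
      case False
      show ?thesis unfolding closure_approachable
      proof (intro allI impI)
        fix e :: real assume "e > 0"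
        have "(l + axis i (complex_of_real (e / 2))) $ i - (l + axis i (complex_of_real (e / 2))) $ j
            = (l $ i - l $ j) + complex_of_real (e / 2)"
          using assms by (simp add: axis_def)
        then have "l + axis i (complex_of_real (e / 2)) \<in> ?U"
          using False \<open>e > 0\<close> by (metis (mono_tags) mem_Collect_eq add_cancel_right_right of_real_eq_0_iff
            half_gt_zero less_irrefl)
        moreover have "dist (l + axis i (complex_of_real (e / 2))) l < e"
          using \<open>e > 0\<close> by (simp add: dist_norm norm_axis)
        ultimately show "\<exists>y\<in>?U. dist y l < e" by blast
      qed
    qed
  qed
qed simp

section \<open>Holomorphic and meromorphic functions of several variables\<close>

lemma holomorphic_fun_on_continuous: 
  "holomorphic_fun_on g U \<Longrightarrow> continuous_on U g"
  unfolding holomorphic_fun_on_def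
  by (meson continuous_at_imp_continuous_on has_derivative_continuous)

lemma holomorphic_fun_on_subset: "holomorphic_fun_on g U \<Longrightarrow> V \<subseteq> U \<Longrightarrow> holomorphic_fun_on g V"
  unfolding holomorphic_fun_on_def by blast

lemma holomorphic_fun_on_coordinate: "holomorphic_fun_on (\<lambda>l. l $ i) U"
  unfolding holomorphic_fun_on_def
  by (intro ballI exI[of _ "\<lambda>v. v $ i"] conjI bounded_linear_imp_has_derivative bounded_linear_vec_nth) auto

lemma holomorphic_fun_on_diff:
  assumes "holomorphic_fun_on g U" "holomorphic_fun_on h U"
  shows "holomorphic_fun_on (\<lambda>l. g l - h l) U"
  unfolding holomorphic_fun_on_def
proof
  fix l assume "l \<in> U"
  with assms obtain D E where "(g has_derivative D) (at l)" "\<forall>c v. D (c *s v) = c * D v"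
     "(h has_derivative E) (at l)" "\<forall>c v. E (c *s v) = c * E v"
    unfolding holomorphic_fun_on_def by meson
  then show "\<exists>D. ((\<lambda>l. g l - h l) has_derivative D) (at l) \<and> (\<forall>c v. D (c *s v) = c * D v)"
    by (intro exI[of _ "\<lambda>v. D v - E v"]) (auto intro!: derivative_eq_intros simp: algebra_simps)
qed

lemma holomorphic_fun_on_mult:
  assumes "holomorphic_fun_on g U" "holomorphic_fun_on h U"
  shows "holomorphic_fun_on (\<lambda>l. g l * h l) U"
  unfolding holomorphic_fun_on_def
proof
  fix l assume "l \<in> U"
  with assms obtain D E where "(g has_derivative D) (at l)" "\<forall>c v. D (c *s v) = c * D v"
     "(h has_derivative E) (at l)" "\<forall>c v. E (c *s v) = c * E v"
    unfolding holomorphic_fun_on_def by meson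
  then show "\<exists>D. ((\<lambda>l. g l * h l) has_derivative D) (at l) \<and> (\<forall>c v. D (c *s v) = c * D v)"
    by (intro exI[of _ "\<lambda>v. g l * E v + D v * h l"]) (auto intro!: derivative_eq_intros simp: algebra_simps)
qed

lemma meromorphic_fun_diff_coordinates:
  assumes "meromorphic_fun f"
  shows "meromorphic_fun (\<lambda>l. f l - (l $ i - l $ j))"
  unfolding meromorphic_fun_def
proof
  fix p :: "'a point"
  from spec[OF assms[unfolded meromorphic_fun_def], of p]
  obtain U g h where *: "open U" "p \<in> U" "holomorphic_fun_on g U" "holomorphic_fun_on h U"
    "\<forall>V. open V \<and> V \<subseteq> U \<and> V \<noteq> {} \<longrightarrow> (\<exists>l\<in>V. h l \<noteq> 0)" "\<forall>l\<in>U. h l \<noteq> 0 \<longrightarrow> f l = g l / h l"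
    by blast
  show "\<exists>U g h. open U \<and> p \<in> U \<and> holomorphic_fun_on g U \<and> holomorphic_fun_on h U \<and>
        (\<forall>V. open V \<and> V \<subseteq> U \<and> V \<noteq> {} \<longrightarrow> (\<exists>l\<in>V. h l \<noteq> 0)) \<and>
        (\<forall>l\<in>U. h l \<noteq> 0 \<longrightarrow> f l - (l $ i - l $ j) = g l / h l)"
  proof (rule exI[of _ U], rule exI[of _ "\<lambda>l. g l - (l $ i - l $ j) * h l"], rule exI[of _ h], intro conjI)
    show "holomorphic_fun_on (\<lambda>l. g l - (l $ i - l $ j) * h l) U"
      using *(3,4) by (simp add: holomorphic_fun_on_diff holomorphic_fun_on_mult holomorphic_fun_on_coordinate)
    show "\<forall>l\<in>U. h l \<noteq> 0 \<longrightarrow> f l - (l $ i - l $ j) = (g l - (l $ i - l $ j) * h l) / h l"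
      using *(6) by (simp add: diff_divide_distrib)
    show "\<forall>V. open V \<and> V \<subseteq> U \<and> V \<noteq> {} \<longrightarrow> (\<exists>l\<in>V. h l \<noteq> 0)" by (rule *(5))
  qed (rule *(1) *(2) *(4))+
qed

text \<open>On a convex domain every point can be joined to an interior zero by a complex line.\<close>

lemma holomorphic_fun_identity:
  fixes g :: "'n::finite point \<Rightarrow> complex"
  assumes g: "holomorphic_fun_on g B" and B: "open B" "convex B"
    and V: "open V" "V \<noteq> {}" "V \<subseteq> B" "\<forall>l\<in>V. g l = 0" and x: "x \<in> B"
  shows "g x = 0"
proof -
  from V obtain q where q: "q \<in> V" by blast
  obtain d where d: "d = x - q" by simp
  define L where "L t = q + t *s d" for t :: complex
  have lin: "bounded_linear (\<lambda>t :: complex. t *s d)"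
    unfolding linear_conv_bounded_linear[symmetric]
    by (rule linearI) (simp_all add: vec_eq_iff algebra_simps)
  have L: "(L has_derivative (\<lambda>t. t *s d)) (at t)" for t
    unfolding L_def by (auto intro!: derivative_eq_intros bounded_linear_imp_has_derivative lin)
  then have cont: "continuous_on UNIV L"
    by (meson continuous_at_imp_continuous_on has_derivative_continuous)
  have holo: "(g \<circ> L) holomorphic_on L -` B"
    unfolding holomorphic_on_def
  proof
    fix t assume "t \<in> L -` B"
    with g obtain D where D: "(g has_derivative D) (at (L t))" "\<And>c v. D (c *s v) = c * D v"
      unfolding holomorphic_fun_on_def by auto
    have "((g \<circ> L) has_derivative (\<lambda>s. D (s *s d))) (at t)"
      using diff_chain_at[OF L D(1)] by (simp add: o_def)
    \<comment> \<open>Complex homogeneity of \<open>D\<close> turns the real derivative along the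
      line into multiplication by \<open>D d\<close>, which is a complex derivative.\<close>
    then have "((g \<circ> L) has_field_derivative D d) (at t)"
      unfolding D(2) has_field_derivative_def by (simp add: mult.commute[of _ "D d"])
    then show "(g \<circ> L) field_differentiable at t within L -` B"
      using field_differentiable_at_within field_differentiable_def by blast
  qed
  \<comment> \<open>Convexity of \<open>B\<close> makes the part of the line inside \<open>B\<close>
    connected, so the one-variable identity theorem carries the zeros from near 0 to the parameter
    1.\<close>
  have "convex (L -` B)"
  proof (rule convexI)
    fix s t u v assume st: "s \<in> L -` B" "t \<in> L -` B" and uv: "0 \<le> u" "0 \<le> v" "u + v = (1 :: real)"
    have "L (u *\<^sub>R s + v *\<^sub>R t) = (u + v) *\<^sub>R q + (u *\<^sub>R s + v *\<^sub>R t) *s d"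
      using uv by (simp add: L_def)
    also have "\<dots> = u *\<^sub>R L s + v *\<^sub>R L t"
      unfolding L_def by (simp add: vec_eq_iff scaleR_left_distrib algebra_simps)
    finally show "u *\<^sub>R s + v *\<^sub>R t \<in> L -` B"
      using convexD[OF B(2), of "L s" "L t" u v] st uv by simp
  qed
  then have "connected (L -` B)" by (rule convex_connected)
  moreover have "open (L -` V)" "open (L -` B)"
    using V(1) B(1) cont by (auto intro: open_vimage)
  moreover have "L 0 = q" "L 1 = x" by (simp_all add: L_def d)
  ultimately have "(g \<circ> L) 1 = 0"
    using q x V(3,4) holo
    by (intro analytic_continuation_open[of "L -` V" "L -` B" "g \<circ> L" "\<lambda>_. 0" 1]) auto
  with \<open>L 1 = x\<close> show ?thesis by simp
qed

text \<open>Shrinking the neighbourhood to a ball supplies the convexity that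
  \<open>holomorphic_fun_identity\<close> requires. Of the holomorphy of \<open>h\<close> only the
  openness of its nonvanishing set is kept.\<close>

lemma meromorphic_fun_ball:
  fixes F :: "'n::finite point \<Rightarrow> complex"
  assumes "meromorphic_fun F"
  obtains r g h where "r > 0" "holomorphic_fun_on g (ball p r)"
    "\<forall>V. open V \<longrightarrow> V \<noteq> {} \<longrightarrow> V \<subseteq> ball p r \<longrightarrow> (\<exists>l\<in>V. h l \<noteq> 0)"
    "open {l \<in> ball p r. h l \<noteq> 0}" "\<forall>l\<in>ball p r. h l \<noteq> 0 \<longrightarrow> F l = g l / h l"
proof -
  from spec[OF assms[unfolded meromorphic_fun_def], of p]
  obtain U g h where *: "open U" "p \<in> U" "holomorphic_fun_on g U" "holomorphic_fun_on h U"
    "\<forall>V. open V \<and> V \<subseteq> U \<and> V \<noteq> {} \<longrightarrow> (\<exists>l\<in>V. h l \<noteq> 0)" "\<forall>l\<in>U. h l \<noteq> 0 \<longrightarrow> F l = g l / h l"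
    by blast
  obtain r where r: "r > 0" "ball p r \<subseteq> U" by (rule openE[OF *(1,2)])
  have "open (ball p r \<inter> h -` (- {0}))"
    by (intro continuous_open_preimage holomorphic_fun_on_continuous holomorphic_fun_on_subset[OF *(4)] r) auto
  moreover have "ball p r \<inter> h -` (- {0}) = {l \<in> ball p r. h l \<noteq> 0}" by auto
  ultimately show ?thesis
  proof (intro that[of r g h])
    show "holomorphic_fun_on g (ball p r)" by (rule holomorphic_fun_on_subset[OF *(3) r(2)])
    show "\<forall>V. open V \<longrightarrow> V \<noteq> {} \<longrightarrow> V \<subseteq> ball p r \<longrightarrow> (\<exists>l\<in>V. h l \<noteq> 0)"
      using *(5) r(2) by (meson order_trans)
    show "\<forall>l\<in>ball p r. h l \<noteq> 0 \<longrightarrow> F l = g l / h l" using *(6) r(2) by (meson subsetD)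
  qed (simp_all add: r(1))
qed

text \<open>If \<open>F\<close> vanished on a nonempty open set, a local numerator would vanish on a
  whole ball by the identity theorem, and connectedness of the space would spread this
  everywhere.\<close>

lemma meromorphic_fun_densely_nonzero:
  fixes F :: "'n::finite point \<Rightarrow> complex"
  assumes F: "meromorphic_fun F" and nz: "\<not> F \<simeq> (\<lambda>l. 0)"
  shows "densely (\<lambda>l. F l \<noteq> 0)"
proof -
  define Z where "Z = interior {l. F l = 0}"
  \<comment> \<open>\<open>Z\<close> may have gaps where a local denominator vanishes, as the values
    of \<open>F\<close> there are arbitrary. Taking the interior of the closure fills them, and the
    result is clopen.\<close>
  define A where "A = interior (closure Z)"
  have FZ: "F l = 0" if "l \<in> Z" for l using that interior_subset unfolding Z_def by blast
  have ZI: "V \<subseteq> Z" if "open V" "\<And>l. l \<in> V \<Longrightarrow> F l = 0" for V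
    unfolding Z_def using that by (intro interior_maximal) auto
  have oZ: "open Z" and oA: "open A" by (simp_all add: Z_def A_def)
  have "closed A"
  proof -
    have "p \<in> A" if p: "p \<in> closure A" for p
    proof -
      obtain r g h where *: "r > 0" "holomorphic_fun_on g (ball p r)"
        "\<forall>V. open V \<longrightarrow> V \<noteq> {} \<longrightarrow> V \<subseteq> ball p r \<longrightarrow> (\<exists>l\<in>V. h l \<noteq> 0)"
        "open {l \<in> ball p r. h l \<noteq> 0}" "\<forall>l\<in>ball p r. h l \<noteq> 0 \<longrightarrow> F l = g l / h l"
        by (rule meromorphic_fun_ball[OF F, where p = p])
      have "A \<inter> ball p r \<noteq> {}"
        using p \<open>r > 0\<close> by (metis open_ball centre_in_ball open_Int_closure_eq_empty Int_commute disjoint_iff)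
      then have "closure Z \<inter> (A \<inter> ball p r) \<noteq> {}"
        unfolding A_def using interior_subset by blast
      then have ne: "Z \<inter> (A \<inter> ball p r) \<noteq> {}"
        using open_Int_closure_eq_empty[of "A \<inter> ball p r" Z] oA by (auto simp: Int_commute)
      define V where "V = Z \<inter> {l \<in> ball p r. h l \<noteq> 0}"
      have "open (Z \<inter> (A \<inter> ball p r))" using oZ oA by auto
      from *(3)[rule_format, OF this ne] have "\<exists>l\<in>Z \<inter> (A \<inter> ball p r). h l \<noteq> 0" by blast
      then have "V \<noteq> {}" by (auto simp: V_def)
      moreover have "open V" unfolding V_def using oZ *(4) by (rule open_Int)
      moreover have "\<forall>l\<in>V. g l = 0" using FZ *(5) by (fastforce simp: V_def)
      moreover have "V \<subseteq> ball p r" by (auto simp: V_def)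
      ultimately have g0: "g l = 0" if "l \<in> ball p r" for l
        using holomorphic_fun_identity[OF *(2), of V l] that by simp
      have "{l \<in> ball p r. h l \<noteq> 0} \<subseteq> Z" by (rule ZI[OF *(4)]) (auto simp: *(5) g0)
      have "ball p r \<subseteq> closure Z"
      proof
        fix l assume l: "l \<in> ball p r"
        show "l \<in> closure Z" unfolding closure_iff_nhds_not_empty
        proof (intro allI impI)
          fix W S assume "S \<subseteq> W" "open S" "l \<in> S"
          then have "\<exists>m\<in>S \<inter> ball p r. h m \<noteq> 0" using l by (intro *(3)[rule_format]) auto
          with \<open>{l \<in> ball p r. h l \<noteq> 0} \<subseteq> Z\<close> \<open>S \<subseteq> W\<close> show "Z \<inter> W \<noteq> {}" by blast
        qed
      qed
      then have "ball p r \<subseteq> A" unfolding A_def by (intro interior_maximal) auto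
      with \<open>r > 0\<close> show ?thesis by auto
    qed
    then show ?thesis by (metis closure_subset closure_eq subsetI subset_antisym)
  qed
  with oA have "A = {} \<or> A = UNIV" using clopen[of A] by simp
  \<comment> \<open>Otherwise the open set \<open>Z\<close> would be dense, which is
    \<open>F \<simeq> (\<lambda>l. 0)\<close>.\<close>
  moreover have "A \<noteq> UNIV"
    using nz interior_subset[of "closure Z"] unfolding mero_eq_densely densely_interior A_def Z_def by blast
  ultimately have A: "A = {}" by blast
  have "p \<in> closure (interior {l. F l \<noteq> 0})" for p
    unfolding closure_iff_nhds_not_empty
  proof (intro allI impI)
    fix W S assume S: "S \<subseteq> W" "open S" "p \<in> S"
    obtain r g h where *: "r > 0" "holomorphic_fun_on g (ball p r)"
      "\<forall>V. open V \<longrightarrow> V \<noteq> {} \<longrightarrow> V \<subseteq> ball p r \<longrightarrow> (\<exists>l\<in>V. h l \<noteq> 0)"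
      "open {l \<in> ball p r. h l \<noteq> 0}" "\<forall>l\<in>ball p r. h l \<noteq> 0 \<longrightarrow> F l = g l / h l"
      by (rule meromorphic_fun_ball[OF F, where p = p])
    let ?H = "{l \<in> ball p r. h l \<noteq> 0}"
    define V where "V = S \<inter> ?H"
    have "\<exists>m\<in>S \<inter> ball p r. h m \<noteq> 0" using S \<open>r > 0\<close> by (intro *(3)[rule_format]) auto
    then have "V \<noteq> {}" by (auto simp: V_def)
    have "open V" unfolding V_def using S *(4) by (intro open_Int)
    have "\<not> V \<subseteq> Z"
    proof
      assume "V \<subseteq> Z"
      then have "V \<subseteq> A" unfolding A_def using \<open>open V\<close> closure_subset by (intro interior_maximal) auto
      with A \<open>V \<noteq> {}\<close> show False by blast
    qed
    with ZI[OF \<open>open V\<close>] obtain m where m: "m \<in> V" "F m \<noteq> 0" by blast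
    \<comment> \<open>Since \<open>F\<close> is a quotient at \<open>m\<close>, the numerator is
      nonzero there. Nonvanishing of \<open>g\<close> and \<open>h\<close> is an open condition,
      whereas \<open>F\<close> itself need not be continuous off the set \<open>?H\<close>.\<close>
    have "open (ball p r \<inter> g -` (- {0}))"
      by (intro continuous_open_preimage holomorphic_fun_on_continuous *(2)) auto
    then have "open (?H \<inter> (ball p r \<inter> g -` (- {0})))" using *(4) by (rule open_Int[rotated])
    moreover have "?H \<inter> (ball p r \<inter> g -` (- {0})) \<subseteq> {l. F l \<noteq> 0}" by (auto simp: *(5))
    ultimately have "?H \<inter> (ball p r \<inter> g -` (- {0})) \<subseteq> interior {l. F l \<noteq> 0}"
      by (intro interior_maximal)
    moreover have "m \<in> ?H \<inter> (ball p r \<inter> g -` (- {0}))"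
      using m *(5)[rule_format, of m] by (auto simp: V_def)
    ultimately have "m \<in> interior {l. F l \<noteq> 0}" by (rule subsetD)
    then show "interior {l. F l \<noteq> 0} \<inter> W \<noteq> {}" using m S by (auto simp: V_def)
  qed
  then show ?thesis unfolding densely_interior by blast
qed

lemma densely_ne_coordinates_diff:
  fixes f :: "'n::finite point \<Rightarrow> complex"
  assumes f: "meromorphic_fun f" "mero_periodic \<gamma> f" and \<gamma>: "\<gamma> \<noteq> 0" and nz: "\<not> f \<simeq> (\<lambda>l. 0)"
  shows "densely (\<lambda>l. f l \<noteq> l $ i - l $ j)"
proof (cases "i = j")
  case True
  then show ?thesis using meromorphic_fun_densely_nonzero[OF f(1) nz] by simp
next
  case False
  have "\<not> (\<lambda>l. f l - (l $ i - l $ j)) \<simeq> (\<lambda>l. 0)"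
  proof
    assume "(\<lambda>l. f l - (l $ i - l $ j)) \<simeq> (\<lambda>l. 0)"
    then have 1: "densely (\<lambda>l. f l - (l $ i - l $ j) = 0)" by (simp add: mero_eq_densely)
    have 2: "densely (\<lambda>l. f (l + axis i \<gamma>) = f l)"
      using f(2) by (simp add: mero_periodic_def mero_eq_densely)
    \<comment> \<open>At a common generic point the shift in coordinate \<open>i\<close> leaves
      \<open>f\<close> unchanged but increases \<open>l $ i - l $ j\<close> by
      \<open>\<gamma>\<close>.\<close>
    obtain l where "f l - (l $ i - l $ j) = 0" "f (l + axis i \<gamma>) = f l"
        "f (l + axis i \<gamma>) - ((l + axis i \<gamma>) $ i - (l + axis i \<gamma>) $ j) = 0"
      using densely_ex[OF densely_conj[OF 1 densely_conj[OF 2 densely_translate[OF 1, of "axis i \<gamma>"]]]]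
      by blast
    with False \<gamma> show False by (simp add: axis_def)
  qed
  from meromorphic_fun_densely_nonzero[OF meromorphic_fun_diff_coordinates[OF f(1)] this]
  show ?thesis by simp
qed

section \<open>Moment vectors and the inverse of the twist\<close>

lemma bij_betw_pos: "bij_betw (pos :: 'n::{finite,linorder} \<Rightarrow> nat) UNIV {1..CARD('n)}"
proof -
  have mono: "pos i < pos j" if "i < j" for i j :: 'n
    unfolding pos_def by (rule psubset_card_mono) (use that in \<open>auto simp: psubset_eq set_eq_iff not_le intro!: exI[of _ j]\<close>)
  have inj: "inj (pos :: 'n \<Rightarrow> nat)"
    by (rule injI) (metis mono less_irrefl linorder_less_linear)
  have "pos i \<in> {1..CARD('n)}" for i :: 'n
  proof -
    have "card {i} \<le> pos i" unfolding pos_def by (rule card_mono) auto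
    moreover have "pos i \<le> CARD('n)" unfolding pos_def by (rule card_mono) auto
    ultimately show ?thesis by simp
  qed
  then have "range (pos :: 'n \<Rightarrow> nat) = {1..CARD('n)}"
    by (intro card_subset_eq) (auto simp: card_image[OF inj])
  with inj show ?thesis by (simp add: bij_betw_def)
qed

lemma pos_ge_1: "1 \<le> pos i" and pos_le_CARD: "pos (i :: 'n::{finite,linorder}) \<le> CARD('n)"
  using bij_betw_apply[OF bij_betw_pos, of i] by auto

lemma sum_over_pos:
  "(\<Sum>i\<in>(UNIV :: 'n::{finite,linorder} set). g (pos i)) = (\<Sum>k=1..CARD('n). g k)"
  by (rule sum.reindex_bij_betw[OF bij_betw_pos])

lemma sum_over_pos_diff:
  "(\<Sum>i\<in>(UNIV :: 'n::{finite,linorder} set). g (pos i - 1)) = (\<Sum>k<CARD('n). g k)"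
  unfolding sum_over_pos[of "\<lambda>k. g (k - 1)"]
  by (rule sum.reindex_bij_witness[of _ Suc "\<lambda>k. k - 1"]) auto

lemma poly_as_sum_lessThan:
  fixes p :: "complex poly"
  assumes "degree p < n"
  shows "(\<Sum>k<n. coeff p k * x ^ k) = poly p x"
  unfolding poly_altdef
  by (rule sum.mono_neutral_right) (use assms in \<open>auto simp: coeff_eq_0\<close>)

lemma sum_coeff_pos:
  assumes "degree p < CARD('n)"
  shows "(\<Sum>k\<in>(UNIV :: 'n::{finite,linorder} set). coeff p (pos k - 1) * x ^ (pos k - 1)) = poly p (x :: complex)"
  using poly_as_sum_lessThan[OF assms] by (simp only: sum_over_pos_diff[of "\<lambda>k. coeff p k * x ^ k"])

text \<open>Differentiating the coefficient sum termwise and using uniqueness of derivatives avoids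
  an index shift in \<open>coeff (pderiv p)\<close>. At \<open>pos k = 1\<close> the truncated
  exponent is harmless because of the factor \<open>of_nat 0\<close>.\<close>

lemma sum_coeff_pos_pderiv:
  assumes "degree p < CARD('n)"
  shows "(\<Sum>k\<in>(UNIV :: 'n::{finite,linorder} set).
     coeff p (pos k - 1) * (of_nat (pos k - 1) * x ^ (pos k - 2))) = poly (pderiv p) (x :: complex)"
proof -
  have "(\<Sum>k<CARD('n). coeff p k * x ^ k) = poly p x" for x
    by (rule poly_as_sum_lessThan[OF assms])
  then have "poly p = (\<lambda>x. \<Sum>k<CARD('n). coeff p k * x ^ k)" by auto
  moreover have "((\<lambda>x. \<Sum>k<CARD('n). coeff p k * x ^ k) has_field_derivative
       (\<Sum>k<CARD('n). coeff p k * (of_nat k * x ^ (k - 1)))) (at x)"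
    by (auto intro!: derivative_eq_intros sum.cong)
  ultimately have "(\<Sum>k<CARD('n). coeff p k * (of_nat k * x ^ (k - 1))) = poly (pderiv p) x"
    using poly_DERIV[of p x] DERIV_unique by metis
  then show ?thesis
    unfolding sum_over_pos_diff[of "\<lambda>k. coeff p k * (of_nat k * x ^ (k - 1))", symmetric]
    by (simp add: numeral_2_eq_2)
qed

section \<open>Nodal polynomials and Lagrange interpolation\<close>

definition nodal :: "'n::finite point \<Rightarrow> 'n \<Rightarrow> complex poly" where
  "nodal l j = (\<Prod>a\<in>UNIV - {j}. [:- (l $ a), 1:])"

lemma poly_nodal: "poly (nodal l j) x = (\<Prod>a\<in>UNIV - {j}. x - l $ a)"
  by (simp add: nodal_def poly_prod)

lemma poly_nodal_split:
  "i \<noteq> j \<Longrightarrow> poly (nodal l i) x = (x - l $ j) * (\<Prod>a\<in>UNIV - {i, j}. x - l $ a)"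
  unfolding poly_nodal by (subst prod.remove[of _ j]) (simp_all add: Diff_insert2[of _ i "{j}"])

lemma poly_nodal_other: "i \<noteq> j \<Longrightarrow> poly (nodal l i) (l $ j) = 0"
  by (simp add: poly_nodal_split)

lemma degree_prod_linear: 
  "degree (\<Prod>a\<in>A. [:- g a, 1:] :: complex poly) = card A"
  by (subst degree_prod_eq_sum_degree) auto

lemma degree_nodal: "degree (nodal l (j :: 'n::finite)) = CARD('n) - 1"
  unfolding nodal_def degree_prod_linear by (simp add: card_Diff_subset)

lemma degree_nodal_less: "degree (nodal l (j :: 'n::finite)) < CARD('n)"
  by (simp add: degree_nodal)

lemma poly_pderiv_nodal_other:
  assumes "i \<noteq> j"
  shows "poly (pderiv (nodal l i)) (l $ j) = (\<Prod>a\<in>UNIV - {i, j}. l $ j - l $ a)"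
proof -
  have "nodal l i = [:- (l $ j), 1:] * (\<Prod>a\<in>UNIV - {i, j}. [:- (l $ a), 1:])"
    unfolding nodal_def using assms by (subst prod.remove[of _ j]) (simp_all add: Diff_insert2[of _ i "{j}"])
  then show ?thesis by (simp add: pderiv_mult pderiv_pCons poly_prod del: mult_pCons_left)
qed

definition binv :: "'n::{finite,linorder} point \<Rightarrow> 'n matr" where
  "binv l = (\<chi> i k. coeff (nodal l i) (pos k - 1))"

lemma binf_eq: "binf l $ i $ j = l $ j ^ (pos i - 1) / poly (nodal l j) (l $ j)"
  by (simp add: binf_def poly_nodal)

lemma poly_nodal_self_nz:
  "inj (($) l) \<Longrightarrow> poly (nodal l j) (l $ j) \<noteq> 0"
  by (auto simp: poly_nodal inj_eq)

lemma binv_power: 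
  "(\<Sum>k\<in>UNIV. binv l $ i $ k * x ^ (pos k - 1)) = poly (nodal l i) x"
  by (simp add: binv_def sum_coeff_pos degree_nodal_less del: One_nat_def)

text \<open>The entries of \<open>binv l ** binf l\<close> are P_i(l_j)/P_j(l_j), the Lagrange
  duality. For square matrices a left inverse is two-sided, and uniqueness then determines the
  choice operator inside \<open>matrix_inv\<close>.\<close>

lemma matrix_inv_binf:
  assumes "inj (($) l)"
  shows "matrix_inv (binf l) = binv l"
proof -
  have "(\<Sum>k\<in>UNIV. binv l $ i $ k * binf l $ k $ j) = (if i = j then 1 else 0)" for i j
    using binv_power[of l i "l $ j"] poly_nodal_self_nz[OF assms]
    by (auto simp: binf_eq poly_nodal_other simp flip: sum_divide_distrib)
  then have 1: "binv l ** binf l = mat 1"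
    by (simp add: vec_eq_iff matrix_matrix_mult_def mat_def)
  then have 2: "binf l ** binv l = mat 1" by (rule matrix_left_right_inverse[THEN iffD1])
  show ?thesis
    unfolding matrix_inv_def
  proof (rule some_equality)
    show "binf l ** binv l = mat 1 \<and> binv l ** binf l = mat 1" using 1 2 by simp
    show "M = binv l" if "binf l ** M = mat 1 \<and> M ** binf l = mat 1" for M
      by (metis that 1 matrix_mul_assoc matrix_mul_rid matrix_mul_lid)
  qed
qed

section \<open>Matrices acting on product vectors\<close>

lemma sum_UNIV_prod:
  "(\<Sum>s\<in>(UNIV :: ('a::finite \<times> 'b::finite) set). g s) = (\<Sum>i\<in>UNIV. \<Sum>j\<in>UNIV. g (i, j))"
  by (simp add: sum.cartesian_product UNIV_Times_UNIV[symmetric] del: UNIV_Times_UNIV)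

lemma tensor_apply:
  "(\<Sum>s\<in>UNIV. (M \<otimes> N) $ r $ s * (u (fst s) * v (snd s))) =
   (\<Sum>s\<in>UNIV. M $ fst r $ s * u s) * (\<Sum>s\<in>UNIV. N $ snd r $ s * v s)"
  by (simp add: tensor_def sum_UNIV_prod sum_product mult_ac)

lemma nunit_apply:
  assumes "1 \<le> q" "q \<le> CARD('n)"
  shows "(\<Sum>s\<in>UNIV. nunit p q $ (r :: 'n::{finite,linorder}) $ s * g (pos s)) =
    (if pos r = p then g q else (0::complex))"
proof -
  have "(\<Sum>s\<in>UNIV. nunit p q $ r $ s * g (pos s)) =
     (\<Sum>k=1..CARD('n). if pos r = p \<and> k = q then g k else 0)"
    unfolding sum_over_pos[where g = "\<lambda>k. if pos r = p \<and> k = q then g k else 0", symmetric]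
    by (rule sum.cong) (auto simp: nunit_def)
  also have "\<dots> = (if pos r = p then g q else 0)" using assms by auto
  finally show ?thesis .
qed

lemma unit_apply: "(\<Sum>s\<in>UNIV. unit i j $ r $ s * g s) = (if r = i then g j else 0)"
proof -
  have "(\<Sum>s\<in>UNIV. unit i j $ r $ s * g s) = (\<Sum>s\<in>UNIV. if s = j then (if r = i then g j else 0) else 0)"
    by (rule sum.cong) (auto simp: unit_def)
  then show ?thesis by simp
qed

lemma sum_if_const_eq:
  "(\<Sum>j\<in>UNIV. if i = (j :: 'a::finite) then g j else 0) = (g i :: complex)"
  "(\<Sum>j\<in>UNIV. if j = (i :: 'a::finite) then g j else 0) = (g i :: complex)"
  by auto

lemma sum_if_swap: "(\<Sum>k\<in>UNIV. if b then g k else 0) = (if b then \<Sum>k\<in>UNIV. g k else (0::complex))"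
  by simp

lemma sum_matrix_apply:
  fixes M :: "'t \<Rightarrow> complex^'b::finite^'a::finite"
  shows "(\<Sum>s\<in>UNIV. (\<Sum>t\<in>T. M t) $ r $ s * w s) = (\<Sum>t\<in>T. \<Sum>s\<in>UNIV. M t $ r $ s * w s)"
proof -
  have "(\<Sum>s\<in>UNIV. (\<Sum>t\<in>T. M t) $ r $ s * w s) = (\<Sum>s\<in>UNIV. \<Sum>t\<in>T. M t $ r $ s * w s)"
    by (simp add: sum_distrib_right)
  also have "\<dots> = (\<Sum>t\<in>T. \<Sum>s\<in>UNIV. M t $ r $ s * w s)" by (rule sum.swap)
  finally show ?thesis .
qed

section \<open>The action of the R-matrix\<close>

text \<open>The entry in row \<open>(a, c)\<close> of the first half of the triple sum in \<open>Rinf\<close>, applied to \<open>\<phi>(x) \<otimes> \<phi>(y)\<close>.\<close>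

definition ladder :: "nat \<Rightarrow> nat \<Rightarrow> complex \<Rightarrow> complex \<Rightarrow> complex" where
  "ladder a c x y = (\<Sum>k=1..a-1. if c \<le> a - k then x ^ (a - k - 1) * y ^ (c + k - 2) else 0)"

text \<open>A \<open>nunit\<close> maps a moment vector to one power in one row. Row
  \<open>(i, j)\<close> therefore selects I = \<open>pos i\<close>, J = \<open>pos j\<close> from
  the first tensor product, and the second one yields the same sum with indices and variables
  exchanged.\<close>

lemma Rinf_ladder:
  fixes i j :: "'n::{finite,linorder}"
  shows "(\<Sum>s\<in>UNIV. Rinf \<gamma> $ (i, j) $ s * (x ^ (pos (fst s) - 1) * y ^ (pos (snd s) - 1))) =
    x ^ (pos i - 1) * y ^ (pos j - 1) + \<gamma> * (ladder (pos i) (pos j) x y - ladder (pos j) (pos i) y x)"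
    (is "?L = _")
proof -
  define w where "w s = x ^ (pos (fst s) - 1) * y ^ (pos (snd s) - 1)" for s :: "'n \<times> 'n"
  let ?a = "\<lambda>M :: 'n matr2. \<Sum>s\<in>UNIV. M $ (i, j) $ s * w s"
  have add: "?a (M + N) = ?a M + ?a N" for M N
    by (simp add: distrib_right sum.distrib)
  have diff: "?a (M - N) = ?a M - ?a N" for M N
    by (simp add: left_diff_distrib sum_subtractf)
  have sm: "?a (c \<cdot> M) = c * ?a M" for c M
    by (simp add: smul_def sum_distrib_left mult_ac)
  have un: "?a (unit p p \<otimes> unit q q) = (if p = i then if q = j then x ^ (pos i - 1) * y ^ (pos j - 1) else 0 else 0)" for p q
    by (simp only: w_def tensor_apply[of _ _ _ "\<lambda>s. x ^ (pos s - 1)" "\<lambda>s. y ^ (pos s - 1)"] unit_apply)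
       auto
  have id: "?a (\<Sum>p\<in>UNIV. \<Sum>q\<in>UNIV. unit p p \<otimes> unit q q) = x ^ (pos i - 1) * y ^ (pos j - 1)"
    by (simp only: sum_matrix_apply un sum_if_swap sum_if_const_eq)
  have nu: "?a (nunit p q \<otimes> nunit p' q') =
      (if pos i = p then x ^ (q - 1) else 0) * (if pos j = p' then y ^ (q' - 1) else 0)"
    if "1 \<le> q" "q \<le> CARD('n)" "1 \<le> q'" "q' \<le> CARD('n)" for p q p' q'
    by (simp only: w_def tensor_apply[of _ _ _ "\<lambda>s. x ^ (pos s - 1)" "\<lambda>s. y ^ (pos s - 1)"]
        nunit_apply[where g = "\<lambda>k. _ ^ (k - 1)", OF that(1,2)] nunit_apply[where g = "\<lambda>k. _ ^ (k - 1)", OF that(3,4)]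
        fst_conv snd_conv)
  have dn: "?a (nunit I (I - k) \<otimes> nunit J (J + k - 1) - nunit J (J + k - 1) \<otimes> nunit I (I - k)) =
        (if pos i = I then x ^ (I - k - 1) else 0) * (if pos j = J then y ^ (J + k - 2) else 0) -
        (if pos i = J then x ^ (J + k - 2) else 0) * (if pos j = I then y ^ (I - k - 1) else 0)"
    if "I \<in> {1..CARD('n)}" "k \<in> {1..I - 1}" "J \<in> {1..I - k}" for I k J
  proof -
    \<comment> \<open>The range of the triple sum keeps both column numbers valid: J \<le> I - k
      gives J + k - 1 \<le> I - 1.\<close>
    have "1 \<le> I - k" "I - k \<le> CARD('n)" "1 \<le> J + k - 1" "J + k - 1 \<le> CARD('n)"
      and "J + k - 1 - 1 = J + k - 2"
      using that by auto
    then show ?thesis by (simp only: diff nu)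
  qed
  have "?a (\<Sum>I = 1..CARD('n). \<Sum>k = 1..I - 1. \<Sum>J = 1..I - k.
        nunit I (I - k) \<otimes> nunit J (J + k - 1) - nunit J (J + k - 1) \<otimes> nunit I (I - k)) =
     (\<Sum>I = 1..CARD('n). \<Sum>k = 1..I - 1. \<Sum>J = 1..I - k.
        (if pos i = I then x ^ (I - k - 1) else 0) * (if pos j = J then y ^ (J + k - 2) else 0) -
        (if pos i = J then x ^ (J + k - 2) else 0) * (if pos j = I then y ^ (I - k - 1) else 0))"
    unfolding sum_matrix_apply by (intro sum.cong refl) (rule dn)
  also have "\<dots> = (\<Sum>I = 1..CARD('n). \<Sum>k = 1..I - 1. \<Sum>J = 1..I - k.
        (if pos i = I then x ^ (I - k - 1) else 0) * (if pos j = J then y ^ (J + k - 2) else 0)) -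
      (\<Sum>I = 1..CARD('n). \<Sum>k = 1..I - 1. \<Sum>J = 1..I - k.
        (if pos i = J then x ^ (J + k - 2) else 0) * (if pos j = I then y ^ (I - k - 1) else 0))"
    unfolding sum_subtractf by (rule refl)
  also have "\<dots> = ladder (pos i) (pos j) x y - ladder (pos j) (pos i) y x"
  proof -
    have "(\<Sum>I = 1..CARD('n). \<Sum>k = 1..I - 1. \<Sum>J = 1..I - k.
        (if p = I then X ^ (I - k - 1) else 0) * (if q = J then Y ^ (J + k - 2) else 0)) = ladder p q X Y"
      if "1 \<le> p" "p \<le> CARD('n)" "1 \<le> q" for p q and X Y :: complex
    proof -
      have "(\<Sum>I = 1..CARD('n). \<Sum>k = 1..I - 1. \<Sum>J = 1..I - k.
          (if p = I then X ^ (I - k - 1) else 0) * (if q = J then Y ^ (J + k - 2) else 0)) =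
        (\<Sum>I = 1..CARD('n). if p = I then \<Sum>k = 1..I - 1. \<Sum>J = 1..I - k.
          X ^ (I - k - 1) * (if q = J then Y ^ (J + k - 2) else 0) else 0)"
        by (intro sum.cong) auto
      also have "\<dots> = (\<Sum>k = 1..p - 1. \<Sum>J = 1..p - k.
          X ^ (p - k - 1) * (if q = J then Y ^ (J + k - 2) else 0))"
        using that by auto
      also have "\<dots> = (\<Sum>k = 1..p - 1. \<Sum>J = 1..p - k.
          if q = J then X ^ (p - k - 1) * Y ^ (q + k - 2) else 0)"
        by (intro sum.cong) auto
      also have "\<dots> = ladder p q X Y"
        unfolding ladder_def using that by (intro sum.cong) auto
      finally show ?thesis .
    qed
    from this[OF pos_ge_1[of i] pos_le_CARD pos_ge_1[of j], of x y]
      this[OF pos_ge_1[of j] pos_le_CARD pos_ge_1[of i], of y x]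
    show ?thesis by (simp only: mult.commute)
  qed
  finally show ?thesis
    unfolding w_def[symmetric] Rinf_def add sm id by simp
qed

text \<open>In terms of exponents, the condition \<open>c \<le> a - k\<close> says k \<le> p - q;
  truncated subtraction makes the sum empty for p \<le> q.\<close>

lemma ladder_reindex:
  "ladder (Suc p) (Suc q) x y = (\<Sum>k<p - q. x ^ (p - 1 - k) * y ^ (q + k))"
proof -
  have "ladder (Suc p) (Suc q) x y = (\<Sum>k=1..p - q. x ^ (p - k) * y ^ (q + k - 1))"
    unfolding ladder_def
    by (rule sum.mono_neutral_cong_right) (auto simp: Suc_diff_le)
  also have "\<dots> = (\<Sum>k<p - q. x ^ (p - 1 - k) * y ^ (q + k))"
    by (rule sum.reindex_bij_witness[of _ Suc "\<lambda>k. k - 1"]) (auto simp: Suc_diff_le)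
  finally show ?thesis .
qed

text \<open>A nonempty ladder is (xy)^q times a geometric sum. At most one of the two ladders is
  nonempty, and since the right-hand side changes sign when both the indices and the variables are
  exchanged into the other ladder's order, both cases give one formula.\<close>

lemma ladder_telescope:
  assumes "1 \<le> a" "1 \<le> c"
  shows "(x - y) * (ladder a c x y - ladder c a y x) =
    x ^ (a - 1) * y ^ (c - 1) - y ^ (a - 1) * x ^ (c - 1)"
proof -
  have main: "(x - y) * (\<Sum>k<p - q. x ^ (p - 1 - k) * y ^ (q + k)) =
      (if q \<le> p then x ^ p * y ^ q - y ^ p * x ^ q else 0)" for p q :: nat and x y :: complex
  proof (cases "q \<le> p")
    case True
    then obtain d where d: "p = q + d" using le_Suc_ex by blast
    have "(x - y) * (\<Sum>k<d. x ^ (q + d - 1 - k) * y ^ (q + k)) = x ^ (q + d) * y ^ q - y ^ (q + d) * x ^ q"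
    proof -
      have "(\<Sum>k<d. x ^ (q + d - 1 - k) * y ^ (q + k)) = (x * y) ^ q * (\<Sum>k<d. x ^ (d - Suc k) * y ^ k)"
        unfolding sum_distrib_left
      proof (intro sum.cong refl)
        fix k assume "k \<in> {..<d}"
        then have "q + d - 1 - k = q + (d - Suc k)" by auto
        then show "x ^ (q + d - 1 - k) * y ^ (q + k) = (x * y) ^ q * (x ^ (d - Suc k) * y ^ k)"
          by (simp add: power_add power_mult_distrib)
      qed
      then have "(x - y) * (\<Sum>k<d. x ^ (q + d - 1 - k) * y ^ (q + k)) =
          (x * y) ^ q * ((x - y) * (\<Sum>k<d. x ^ (d - Suc k) * y ^ k))" by simp
      also have "(x - y) * (\<Sum>k<d. x ^ (d - Suc k) * y ^ k) = x ^ d - y ^ d"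
        using power_diff_sumr2[of y d x] by (simp add: algebra_simps)
      finally show ?thesis by (simp add: power_add power_mult_distrib algebra_simps)
    qed
    with d show ?thesis by simp
  qed simp
  obtain p q where pq: "a = Suc p" "c = Suc q"
    using assms by (metis Suc_le_D One_nat_def)
  have "(x - y) * (ladder a c x y - ladder c a y x) =
     (x - y) * ladder a c x y + (y - x) * ladder c a y x" by (simp add: algebra_simps)
  also have "\<dots> = (if q \<le> p then x ^ p * y ^ q - y ^ p * x ^ q else 0) +
      (if p \<le> q then y ^ q * x ^ p - x ^ q * y ^ p else 0)"
    unfolding pq ladder_reindex main by simp
  also have "\<dots> = x ^ p * y ^ q - y ^ p * x ^ q" by (auto simp: mult.commute)
  finally show ?thesis by (simp add: pq)
qed

text \<open>On the diagonal all p - q monomials equal x^(p+q-1). Splitting the count into p and q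
  separates the derivative of one leg from that of the other.\<close>

lemma ladder_diag:
  assumes "1 \<le> a" "1 \<le> c"
  shows "ladder a c x x - ladder c a x x =
    of_nat (a - 1) * x ^ (a - 2) * x ^ (c - 1) - x ^ (a - 1) * (of_nat (c - 1) * x ^ (c - 2))"
proof -
  have main: "(\<Sum>k<p - q. x ^ (p - 1 - k) * x ^ (q + k)) =
      (of_nat p * x ^ (p - 1) * x ^ q - x ^ p * (of_nat q * x ^ (q - 1)))" if "q \<le> p"
     for p q :: nat and x :: complex
  proof -
    have "(\<Sum>k<p - q. x ^ (p - 1 - k) * x ^ (q + k)) = (\<Sum>k<p - q. x ^ (p + q - 1))"
      by (intro sum.cong refl) (auto simp flip: power_add)
    also have "\<dots> = of_nat (p - q) * x ^ (p + q - 1)" by simp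
    also have "\<dots> = of_nat p * x ^ (p - 1) * x ^ q - x ^ p * (of_nat q * x ^ (q - 1))"
      using that by (cases p; cases q) (auto simp: of_nat_diff power_add algebra_simps)
    finally show ?thesis .
  qed
  obtain p q where pq: "a = Suc p" "c = Suc q"
    using assms by (metis Suc_le_D One_nat_def)
  show ?thesis
    using main[of q p x] main[of p q x]
    by (cases "q \<le> p") (simp_all add: pq ladder_reindex numeral_2_eq_2 mult_ac)
qed

lemma Rinf_power:
  fixes i j :: "'n::{finite,linorder}"
  assumes "x \<noteq> y"
  shows "(\<Sum>s\<in>UNIV. Rinf \<gamma> $ (i, j) $ s * (x ^ (pos (fst s) - 1) * y ^ (pos (snd s) - 1))) =
    (1 + \<gamma> / (x - y)) * (x ^ (pos i - 1) * y ^ (pos j - 1)) -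
    \<gamma> / (x - y) * (y ^ (pos i - 1) * x ^ (pos j - 1))"
proof -
  have quot: "ladder (pos i) (pos j) x y - ladder (pos j) (pos i) y x =
    (x ^ (pos i - 1) * y ^ (pos j - 1) - y ^ (pos i - 1) * x ^ (pos j - 1)) / (x - y)"
    using ladder_telescope[OF pos_ge_1 pos_ge_1, of x y i j] assms by (simp add: field_simps)
  show ?thesis unfolding Rinf_ladder quot by (simp add: diff_divide_distrib algebra_simps)
qed

text \<open>The functional with coefficient vectors \<open>p\<close> and \<open>q\<close>, applied
  to \<open>M\<close> acting on a product of two moment vectors; for degrees below n and
  \<open>M\<close> the identity it is p(x) q(y). Entries of the twisted A and D have this form,
  since rows of \<open>binv\<close> are coefficient vectors and columns of \<open>binf\<close> are
  scaled moment vectors.\<close>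

definition sandwich :: "complex poly \<Rightarrow> complex poly \<Rightarrow> 'n::{finite,linorder} matr2 \<Rightarrow> complex \<Rightarrow> complex \<Rightarrow> complex" where
  "sandwich p q M x y = (\<Sum>r\<in>UNIV. coeff p (pos (fst r) - 1) * coeff q (pos (snd r) - 1) *
     (\<Sum>s\<in>UNIV. M $ r $ s * (x ^ (pos (fst s) - 1) * y ^ (pos (snd s) - 1))))"

lemma sum_pair_product:
  "(\<Sum>r\<in>UNIV. u (fst r) * v (snd r)) = (\<Sum>i\<in>UNIV. u (i::'a::finite)) * (\<Sum>j\<in>UNIV. v (j::'b::finite) :: complex)"
  by (simp add: sum_UNIV_prod sum_product)

lemma sandwich_Rinf:
  fixes p q :: "complex poly"
  assumes deg: "degree p < CARD('n)" "degree q < CARD('n)" and "x \<noteq> y"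
  shows "sandwich p q (Rinf \<gamma> :: 'n::{finite,linorder} matr2) x y =
    (1 + \<gamma> / (x - y)) * (poly p x * poly q y) - \<gamma> / (x - y) * (poly p y * poly q x)"
proof -
  let ?P = "\<lambda>p x (k :: 'n). coeff p (pos k - 1) * x ^ (pos k - 1)"
  have "sandwich p q (Rinf \<gamma> :: 'n matr2) x y = 
    (\<Sum>r\<in>(UNIV :: ('n \<times> 'n) set). coeff p (pos (fst r) - 1) * coeff q (pos (snd r) - 1) *
      ((1 + \<gamma> / (x - y)) * (x ^ (pos (fst r) - 1) * y ^ (pos (snd r) - 1)) -
    \<gamma> / (x - y) * (y ^ (pos (fst r) - 1) * x ^ (pos (snd r) - 1))))"
    unfolding sandwich_def
    by (rule sum.cong) (simp_all only: Rinf_power[OF assms(3), of \<gamma> "fst r" "snd r" for r, unfolded prod.collapse])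
  also have "\<dots> = (1 + \<gamma> / (x - y)) * (\<Sum>r\<in>UNIV. ?P p x (fst r) * ?P q y (snd r)) -
      \<gamma> / (x - y) * (\<Sum>r\<in>UNIV. ?P p y (fst r) * ?P q x (snd r))"
    unfolding sum_distrib_left sum_subtractf[symmetric]
    by (rule sum.cong) (auto simp: algebra_simps)
  finally show ?thesis
    unfolding sum_pair_product[of "?P p x" "?P q y"] sum_pair_product[of "?P p y" "?P q x"] sum_coeff_pos[OF deg(1)] sum_coeff_pos[OF deg(2)] .
qed

text \<open>Serves the columns of A with equal indices, where both legs carry the same node.\<close>

lemma sandwich_Rinf_diag:
  fixes p q :: "complex poly"
  assumes deg: "degree p < CARD('n)" "degree q < CARD('n)"
  shows "sandwich p q (Rinf \<gamma> :: 'n::{finite,linorder} matr2) x x =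
    poly p x * poly q x + \<gamma> * (poly (pderiv p) x * poly q x - poly p x * poly (pderiv q) x)"
proof -
  let ?P = "\<lambda>p (k :: 'n). coeff p (pos k - 1) * x ^ (pos k - 1)"
  let ?D = "\<lambda>p (k :: 'n). coeff p (pos k - 1) * (of_nat (pos k - 1) * x ^ (pos k - 2))"
  have "sandwich p q (Rinf \<gamma> :: 'n matr2) x x = 
    (\<Sum>r\<in>(UNIV :: ('n \<times> 'n) set). coeff p (pos (fst r) - 1) * coeff q (pos (snd r) - 1) *
      (x ^ (pos (fst r) - 1) * x ^ (pos (snd r) - 1) + \<gamma> *
       (of_nat (pos (fst r) - 1) * x ^ (pos (fst r) - 2) * x ^ (pos (snd r) - 1) -
        x ^ (pos (fst r) - 1) * (of_nat (pos (snd r) - 1) * x ^ (pos (snd r) - 2)))))"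
    unfolding sandwich_def
    by (rule sum.cong)
      (simp_all only: Rinf_ladder[of \<gamma> "fst r" "snd r" x x for r, unfolded prod.collapse ladder_diag[OF pos_ge_1 pos_ge_1]])
  also have "\<dots> = (\<Sum>r\<in>UNIV. ?P p (fst r) * ?P q (snd r)) +
      \<gamma> * ((\<Sum>r\<in>UNIV. ?D p (fst r) * ?P q (snd r)) - (\<Sum>r\<in>UNIV. ?P p (fst r) * ?D q (snd r)))"
    unfolding sum_subtractf[symmetric] sum_distrib_left sum.distrib[symmetric]
    by (rule sum.cong) (auto simp: algebra_simps)
  finally show ?thesis
    unfolding sum_pair_product[of "?P p" "?P q"] sum_pair_product[of "?D p" "?P q"]
      sum_pair_product[of "?P p" "?D q"] sum_coeff_pos[OF deg(1)] sum_coeff_pos[OF deg(2)]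
      sum_coeff_pos_pderiv[OF deg(1)] sum_coeff_pos_pderiv[OF deg(2)] .
qed

section \<open>The Yang-Baxter equation on triple moment vectors\<close>

definition power_tensor :: "complex \<Rightarrow> complex \<Rightarrow> complex \<Rightarrow> complex^('n::{finite,linorder} \<times> 'n \<times> 'n)" where
  "power_tensor x y z = (\<chi> t. case t of (i, j, k) \<Rightarrow> x ^ (pos i - 1) * y ^ (pos j - 1) * z ^ (pos k - 1))"

lemma leg12_Rinf_power_tensor:
  assumes "x \<noteq> y"
  shows "leg12 (Rinf \<gamma> :: 'n::{finite,linorder} matr2) *v power_tensor x y z =
    (1 + \<gamma> / (x - y)) *s power_tensor x y z - (\<gamma> / (x - y)) *s power_tensor y x z"
proof -
  have "(leg12 (Rinf \<gamma> :: 'n matr2) *v power_tensor x y z) $ (i, j, k) =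
     (\<Sum>s\<in>UNIV. Rinf \<gamma> $ (i, j) $ s * (x ^ (pos (fst s) - 1) * y ^ (pos (snd s) - 1))) * z ^ (pos k - 1)"
    for i j k :: 'n
  proof -
    have "(leg12 (Rinf \<gamma> :: 'n matr2) *v power_tensor x y z) $ (i, j, k) =
       (\<Sum>i'\<in>UNIV. \<Sum>j'\<in>UNIV. \<Sum>k'\<in>UNIV. if k = k' then Rinf \<gamma> $ (i, j) $ (i', j') *
          (x ^ (pos i' - 1) * y ^ (pos j' - 1) * z ^ (pos k' - 1)) else 0)"
      unfolding matrix_vector_mult_def power_tensor_def leg12_def
      by (simp add: sum_UNIV_prod if_distrib[of "\<lambda>t. t * _"] cong: if_cong)
    then show ?thesis
      by (simp add: sum_if_swap sum_if_const_eq sum_UNIV_prod sum_distrib_right sum_distrib_left mult_ac del: sum.delta sum.delta')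
  qed
  then show ?thesis
    unfolding Rinf_power[OF assms] by (simp add: vec_eq_iff power_tensor_def algebra_simps)
qed

lemma leg13_Rinf_power_tensor:
  assumes "x \<noteq> z"
  shows "leg13 (Rinf \<gamma> :: 'n::{finite,linorder} matr2) *v power_tensor x y z =
    (1 + \<gamma> / (x - z)) *s power_tensor x y z - (\<gamma> / (x - z)) *s power_tensor z y x"
proof -
  have "(leg13 (Rinf \<gamma> :: 'n matr2) *v power_tensor x y z) $ (i, j, k) =
     (\<Sum>s\<in>UNIV. Rinf \<gamma> $ (i, k) $ s * (x ^ (pos (fst s) - 1) * z ^ (pos (snd s) - 1))) * y ^ (pos j - 1)"
    for i j k :: 'n
  proof -
    have "(leg13 (Rinf \<gamma> :: 'n matr2) *v power_tensor x y z) $ (i, j, k) =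
       (\<Sum>i'\<in>UNIV. \<Sum>j'\<in>UNIV. \<Sum>k'\<in>UNIV. if j = j' then Rinf \<gamma> $ (i, k) $ (i', k') *
          (x ^ (pos i' - 1) * y ^ (pos j' - 1) * z ^ (pos k' - 1)) else 0)"
      unfolding matrix_vector_mult_def power_tensor_def leg13_def
      by (simp add: sum_UNIV_prod if_distrib[of "\<lambda>t. t * _"] cong: if_cong)
    then show ?thesis
      by (simp add: sum_if_swap sum_if_const_eq sum_UNIV_prod sum_distrib_right sum_distrib_left mult_ac del: sum.delta sum.delta')
  qed
  then show ?thesis
    unfolding Rinf_power[OF assms] by (simp add: vec_eq_iff power_tensor_def algebra_simps)
qed

lemma leg23_Rinf_power_tensor:
  assumes "y \<noteq> z"
  shows "leg23 (Rinf \<gamma> :: 'n::{finite,linorder} matr2) *v power_tensor x y z =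
    (1 + \<gamma> / (y - z)) *s power_tensor x y z - (\<gamma> / (y - z)) *s power_tensor x z y"
proof -
  have "(leg23 (Rinf \<gamma> :: 'n matr2) *v power_tensor x y z) $ (i, j, k) =
     (\<Sum>s\<in>UNIV. Rinf \<gamma> $ (j, k) $ s * (y ^ (pos (fst s) - 1) * z ^ (pos (snd s) - 1))) * x ^ (pos i - 1)"
    for i j k :: 'n
  proof -
    have "(leg23 (Rinf \<gamma> :: 'n matr2) *v power_tensor x y z) $ (i, j, k) =
       (\<Sum>i'\<in>UNIV. \<Sum>j'\<in>UNIV. \<Sum>k'\<in>UNIV. if i = i' then Rinf \<gamma> $ (j, k) $ (j', k') *
          (x ^ (pos i' - 1) * y ^ (pos j' - 1) * z ^ (pos k' - 1)) else 0)"
      unfolding matrix_vector_mult_def power_tensor_def leg23_def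
      by (simp add: sum_UNIV_prod if_distrib[of "\<lambda>t. t * _"] cong: if_cong)
    then show ?thesis
      by (simp add: sum_if_swap sum_if_const_eq sum_UNIV_prod sum_distrib_right sum_distrib_left mult_ac del: sum.delta sum.delta')
  qed
  then show ?thesis
    unfolding Rinf_power[OF assms] by (simp add: vec_eq_iff power_tensor_def algebra_simps)
qed

text \<open>A polynomial with infinitely many roots is zero. The finite exceptional set
  \<open>S\<close> makes it possible to test only at pairwise distinct arguments, where R has its
  divided-difference form.\<close>

lemma power_sum_zero_imp_zero:
  fixes c :: "'n::{finite,linorder} \<Rightarrow> complex"
  assumes "\<And>x. x \<notin> S \<Longrightarrow> (\<Sum>i\<in>UNIV. c i * x ^ (pos i - 1)) = 0" and "finite S"
  shows "c i = 0"
proof (rule ccontr)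
  assume "c i \<noteq> 0"
  define d where "d k = c (the_inv_into UNIV pos (Suc k))" for k
  have d: "d (pos j - 1) = c j" for j
    unfolding d_def using pos_ge_1[of j] bij_betw_imp_inj_on[OF bij_betw_pos[where 'n = 'n]] by (simp add: the_inv_f_f)
  have card: "1 \<le> CARD('n)" using pos_ge_1[of i] pos_le_CARD[of i] by simp
  have "(\<Sum>i\<in>UNIV. c i * x ^ (pos i - 1)) = (\<Sum>k\<le>CARD('n) - 1. d k * x ^ k)" for x
  proof -
    have "(\<Sum>i\<in>UNIV. c i * x ^ (pos i - 1)) = (\<Sum>k<CARD('n). d k * x ^ k)"
      unfolding sum_over_pos_diff[of "\<lambda>k. d k * x ^ k", symmetric] d ..
    also have "{..<CARD('n)} = {..CARD('n) - 1}"
      using card by (metis Suc_diff_1 less_eq_Suc_le One_nat_def lessThan_Suc_atMost)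
    finally show ?thesis .
  qed
  with assms(1) have "- S \<subseteq> {x. (\<Sum>k\<le>CARD('n) - 1. d k * x ^ k) = 0}" by auto
  moreover have "finite {x. (\<Sum>k\<le>CARD('n) - 1. d k * x ^ k) = 0}"
    by (rule polyfun_roots_finite[of d "pos i - 1"])
      (use \<open>c i \<noteq> 0\<close> pos_le_CARD[of i] in \<open>auto simp: d[unfolded One_nat_def]\<close>)
  ultimately have "finite (- S)" by (rule finite_subset)
  with \<open>finite S\<close> show False
    using infinite_UNIV_char_0[where 'a = complex] by (metis finite_Un Compl_partition)
qed

text \<open>Triple moment vectors at pairwise distinct arguments span the space: the variables are
  stripped off in the order z, y, x, avoiding {x, y}, then {x}, then nothing.\<close>

lemma matrix_eq_if_power_tensor:
  fixes M N :: "'n::{finite,linorder} matr3"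
  assumes "\<And>x y z. x \<noteq> y \<Longrightarrow> x \<noteq> z \<Longrightarrow> y \<noteq> z \<Longrightarrow> M *v power_tensor x y z = N *v power_tensor x y z"
  shows "M = N"
proof -
  have "M $ r $ (i, j, k) - N $ r $ (i, j, k) = 0" for r i j k
  proof -
    let ?c = "\<lambda>i j k. M $ r $ (i, j, k) - N $ r $ (i, j, k)"
    have 0: "(\<Sum>k\<in>UNIV. (\<Sum>j\<in>UNIV. (\<Sum>i\<in>UNIV. ?c i j k * x ^ (pos i - 1)) * y ^ (pos j - 1)) * z ^ (pos k - 1)) = 0"
      if "x \<noteq> y" "x \<noteq> z" "y \<noteq> z" for x y z
    proof -
      have "(\<Sum>i\<in>UNIV. \<Sum>j\<in>UNIV. \<Sum>k\<in>UNIV. ?c i j k * (x ^ (pos i - 1) * y ^ (pos j - 1) * z ^ (pos k - 1))) = 0"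
        using arg_cong[OF assms[OF that], of "\<lambda>v. v $ r"]
        by (simp add: matrix_vector_mult_def power_tensor_def sum_UNIV_prod left_diff_distrib sum_subtractf)
      also have "(\<Sum>i\<in>UNIV. \<Sum>j\<in>UNIV. \<Sum>k\<in>UNIV. ?c i j k * (x ^ (pos i - 1) * y ^ (pos j - 1) * z ^ (pos k - 1))) =
        (\<Sum>i\<in>UNIV. \<Sum>k\<in>UNIV. \<Sum>j\<in>UNIV. ?c i j k * (x ^ (pos i - 1) * y ^ (pos j - 1) * z ^ (pos k - 1)))"
        by (intro sum.cong refl sum.swap)
      also have "\<dots> = (\<Sum>k\<in>UNIV. \<Sum>i\<in>UNIV. \<Sum>j\<in>UNIV. ?c i j k * (x ^ (pos i - 1) * y ^ (pos j - 1) * z ^ (pos k - 1)))"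
        by (rule sum.swap)
      also have "\<dots> = (\<Sum>k\<in>UNIV. \<Sum>j\<in>UNIV. \<Sum>i\<in>UNIV. ?c i j k * (x ^ (pos i - 1) * y ^ (pos j - 1) * z ^ (pos k - 1)))"
        by (intro sum.cong refl sum.swap)
      also have "\<dots> = (\<Sum>k\<in>UNIV. (\<Sum>j\<in>UNIV. (\<Sum>i\<in>UNIV. ?c i j k * x ^ (pos i - 1)) * y ^ (pos j - 1)) * z ^ (pos k - 1))"
        by (simp only: sum_distrib_right mult.assoc)
      finally show ?thesis .
    qed
    have 1: "(\<Sum>j\<in>UNIV. (\<Sum>i\<in>UNIV. ?c i j k * x ^ (pos i - 1)) * y ^ (pos j - 1)) = 0" if "x \<noteq> y" for x y
      by (rule power_sum_zero_imp_zero[of "{x, y}"]) (use that 0 in auto)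
    have 2: "(\<Sum>i\<in>UNIV. ?c i j k * x ^ (pos i - 1)) = 0" for x
      by (rule power_sum_zero_imp_zero[of "{x}"]) (use 1 in auto)
    show ?thesis
      by (rule power_sum_zero_imp_zero[of "{}" "\<lambda>i. ?c i j k"]) (use 2 in auto)
  qed
  then show ?thesis by (simp add: vec_eq_iff)
qed

lemma Rinf_Yang_Baxter:
  fixes \<gamma> :: complex
  defines "R \<equiv> Rinf \<gamma> :: 'n::{finite,linorder} matr2"
  shows "leg12 R ** leg13 R ** leg23 R = leg23 R ** leg13 R ** leg12 R"
proof (rule matrix_eq_if_power_tensor)
  fix x y z :: complex
  assume ne: "x \<noteq> y" "x \<noteq> z" "y \<noteq> z"
  define a b c where abc: "a = \<gamma> / (x - y)" "b = \<gamma> / (x - z)" "c = \<gamma> / (y - z)"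
  have neg: "\<gamma> / (y - x) = - a" "\<gamma> / (z - x) = - b" "\<gamma> / (z - y) = - c"
    unfolding abc by (simp_all add: minus_divide_right del: minus_divide_left)
  \<comment> \<open>Partial fractions, used with u = x - y, v = y - z and u + v = x - z. The
    resulting relation between \<open>a\<close>, \<open>b\<close>, \<open>c\<close> is what makes
    the coefficients of the six permuted moment vectors match.\<close>
  have "\<gamma> / u * (\<gamma> / v) = \<gamma> / (u + v) * (\<gamma> / u + \<gamma> / v)"
    if "u \<noteq> 0" "v \<noteq> 0" "u + v \<noteq> 0" for u v
    using that by (simp add: divide_simps) (simp add: algebra_simps)
  from this[of "x - y" "y - z"] have "a * c = b * (a + c)"
    using ne unfolding abc by simp
  note R12 = leg12_Rinf_power_tensor[where 'n = 'n and \<gamma> = \<gamma>, folded R_def]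
  note R13 = leg13_Rinf_power_tensor[where 'n = 'n and \<gamma> = \<gamma>, folded R_def]
  note R23 = leg23_Rinf_power_tensor[where 'n = 'n and \<gamma> = \<gamma>, folded R_def]
  note lin = matrix_vector_mult_diff_distrib vector_scalar_commute
  show "leg12 R ** leg13 R ** leg23 R *v power_tensor x y z =
        leg23 R ** leg13 R ** leg12 R *v power_tensor x y z"
    unfolding matrix_vector_mul_assoc[symmetric] vec_eq_iff
    by (simp only: R12 R13 R23 ne ne[symmetric] lin not_False_eq_True vector_minus_component
          vector_smult_component neg abc[symmetric])
       (use \<open>a * c = b * (a + c)\<close> in algebra)
qed

section \<open>Entries of the twisted matrices\<close>

text \<open>Each summand of A, B and D is supported in a single row, \<open>(a, c)\<close> for A and
  D and \<open>(c, a)\<close> for B, so an entry sees at most one term of the sum.\<close>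

lemma sum_offdiag_delta:
  fixes g :: "'n::finite \<Rightarrow> 'n \<Rightarrow> complex"
  assumes "\<And>a c. a \<noteq> c \<Longrightarrow> (a, c) \<noteq> (i, j) \<Longrightarrow> g a c = 0"
  shows "(\<Sum>(a, c)\<in>{(a, c). a \<noteq> c}. g a c) = (if i \<noteq> j then g i j else 0)"
proof -
  have "(\<Sum>(a, c)\<in>{(a, c). a \<noteq> c}. g a c) = (\<Sum>(a, c)\<in>(if i \<noteq> j then {(i, j)} else {}). g a c)"
    by (rule sum.mono_neutral_right) (use assms in \<open>auto split: if_splits\<close>)
  then show ?thesis by simp
qed

lemma sum_component2:
  "(\<Sum>t\<in>T. M t :: complex^'b::finite^'a::finite) $ r $ s = (\<Sum>t\<in>T. M t $ r $ s)"
  by simp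

lemmas entry_simps = smul_def tensor_def unit_def mat_def

lemma Ainf_entry:
  "Ainf \<gamma> l $ (i, j) $ (p, q) = of_bool (i = p \<and> j = q) +
    (if i \<noteq> j then \<gamma> / (l $ i - l $ j) * ((of_bool (p = i) - of_bool (p = j)) * (of_bool (q = j) - of_bool (q = i))) else 0)"
proof -
  let ?T = "\<lambda>a c. ((\<gamma> / (l $ a - l $ c)) \<cdot> ((unit a a - unit a c) \<otimes> (unit c c - unit c a))) $ (i, j) $ (p, q)"
  have "(\<Sum>(a, c)\<in>{(a, c). a \<noteq> c}. ?T a c) = (if i \<noteq> j then ?T i j else 0)"
    by (rule sum_offdiag_delta) (auto simp: entry_simps)
  then show ?thesis
    by (auto simp: Ainf_def case_prod_unfold entry_simps)
qed

lemma Binf_entry: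
  "Binf \<gamma> l $ (i, j) $ (p, q) = of_bool (i = p \<and> j = q) +
    (if i \<noteq> j then \<gamma> / (l $ j - l $ i - \<gamma>) * (of_bool (p = i) * (of_bool (q = j) - of_bool (q = i))) else 0)"
proof -
  let ?T = "\<lambda>a c. ((\<gamma> / (l $ a - l $ c - \<gamma>)) \<cdot> (unit c c \<otimes> (unit a a - unit a c))) $ (i, j) $ (p, q)"
  have "(\<Sum>(a, c)\<in>{(a, c). a \<noteq> c}. ?T a c) = (if j \<noteq> i then ?T j i else 0)"
    by (rule sum_offdiag_delta) (auto simp: entry_simps)
  then show ?thesis
    by (auto simp: Binf_def case_prod_unfold entry_simps)
qed

lemma Dinf_entry:
  "Dinf \<gamma> l $ (i, j) $ (p, q) = of_bool (i = p \<and> j = q) +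
    (if i \<noteq> j then \<gamma> / (l $ i - l $ j) * (of_bool (p = j \<and> q = i) - of_bool (p = i \<and> q = j)) else 0)"
proof -
  let ?T = "\<lambda>a c. ((\<gamma> / (l $ a - l $ c)) \<cdot> (unit a c \<otimes> unit c a - unit a a \<otimes> unit c c)) $ (i, j) $ (p, q)"
  have "(\<Sum>(a, c)\<in>{(a, c). a \<noteq> c}. ?T a c) = (if i \<noteq> j then ?T i j else 0)"
    by (rule sum_offdiag_delta) (auto simp: entry_simps)
  then show ?thesis
    by (auto simp: Dinf_def case_prod_unfold entry_simps)
qed

lemma leg1_shift_entry:
  "leg1_shift \<gamma> M l $ (i, j) $ (p, q) = (if j = q then M (l + axis j \<gamma>) $ i $ p else 0)"
proof -
  have "leg1_shift \<gamma> M l $ (i, j) $ (p, q) = (\<Sum>m\<in>UNIV. if m = j then if j = q then M (l + axis m \<gamma>) $ i $ p else 0 else 0)"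
    unfolding leg1_shift_def sum_component2 by (rule sum.cong) (auto simp: entry_simps)
  then show ?thesis by simp
qed

lemma leg2_shift_entry:
  "leg2_shift \<gamma> M l $ (i, j) $ (p, q) = (if i = p then M (l + axis i \<gamma>) $ j $ q else 0)"
proof -
  have "leg2_shift \<gamma> M l $ (i, j) $ (p, q) = (\<Sum>m\<in>UNIV. if m = i then if i = p then M (l + axis m \<gamma>) $ j $ q else 0 else 0)"
    unfolding leg2_shift_def sum_component2 by (rule sum.cong) (auto simp: entry_simps)
  then show ?thesis by simp
qed

lemma leg1_entry: "leg1 M $ (i, j) $ (p, q) = (if j = q then M $ i $ p else 0)"
  and leg2_entry: "leg2 M $ (i, j) $ (p, q) = (if i = p then M $ j $ q else 0)"
  by (auto simp: leg1_def leg2_def entry_simps)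

text \<open>The order of the factors decides which index carries the shift: left of
  \<open>leg2 N\<close> it is the row index \<open>j\<close>, right of \<open>leg1 M\<close> the
  column index \<open>p\<close>.\<close>

lemma leg_mult_entry:
  fixes M N :: "'n::finite matr" and M' :: "'n point \<Rightarrow> 'n matr"
  shows "(leg1 M ** leg2 N) $ (i, j) $ (p, q) = M $ i $ p * N $ j $ q"
    and "(leg1_shift \<gamma> M' l ** leg2 N) $ (i, j) $ (p, q) = M' (l + axis j \<gamma>) $ i $ p * N $ j $ q"
    and "(leg1 M ** leg2_shift \<gamma> M' l) $ (i, j) $ (p, q) = M $ i $ p * M' (l + axis p \<gamma>) $ j $ q"
    and "(leg2 M ** leg2_shift \<gamma> M' l) $ (i, j) $ (p, q) =
      (if i = p then \<Sum>k\<in>UNIV. M $ j $ k * M' (l + axis i \<gamma>) $ k $ q else 0)"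
  by (simp_all add: matrix_matrix_mult_def sum_UNIV_prod leg1_entry leg2_entry leg1_shift_entry leg2_shift_entry
        if_distrib[of "\<lambda>t. t * _"] if_distrib[of "\<lambda>t. _ * t"] sum_if_const_eq sum_if_swap cong: if_cong)

lemma sandwich_entry:
  fixes L M U :: "'n::{finite,linorder} matr2"
  assumes "\<And>r1 r2. L $ t $ (r1, r2) = coeff p (pos r1 - 1) * coeff q (pos r2 - 1)"
    and "\<And>s1 s2. U $ (s1, s2) $ t' = x ^ (pos s1 - 1) * y ^ (pos s2 - 1) / d"
  shows "(L ** M ** U) $ t $ t' = sandwich p q M x y / d"
proof -
  have L: "L $ t $ r = coeff p (pos (fst r) - 1) * coeff q (pos (snd r) - 1)" for r
    using assms(1)[of "fst r" "snd r"] by simp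
  have U: "U $ s $ t' = x ^ (pos (fst s) - 1) * y ^ (pos (snd s) - 1) / d" for s
    using assms(2)[of "fst s" "snd s"] by simp
  have "(L ** M ** U) $ t $ t' = (\<Sum>s\<in>UNIV. \<Sum>r\<in>UNIV. L $ t $ r * M $ r $ s * U $ s $ t')"
    by (simp add: matrix_matrix_mult_def sum_distrib_right)
  also have "\<dots> = (\<Sum>r\<in>UNIV. \<Sum>s\<in>UNIV. L $ t $ r * M $ r $ s * U $ s $ t')"
    by (rule sum.swap)
  also have "\<dots> = sandwich p q M x y / d"
    unfolding sandwich_def L U by (simp add: sum_divide_distrib sum_distrib_left mult.assoc)
  finally show ?thesis .
qed

section \<open>Interpolation denominators and their shifts\<close>

definition denom :: "'n::finite point \<Rightarrow> 'n \<Rightarrow> complex" where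
  "denom l j = poly (nodal l j) (l $ j)"

lemma poly_nodal_at: "poly (nodal l i) (l $ p) = (if i = p then denom l p else 0)"
  by (auto simp: denom_def poly_nodal_other)

lemma denom_nz: "inj (($) l) \<Longrightarrow> denom l j \<noteq> 0"
  by (simp add: denom_def poly_nodal_self_nz)

lemma binf_denom: "binf l $ i $ j = l $ j ^ (pos i - 1) / denom l j"
  by (simp add: binf_eq denom_def)

text \<open>As \<open>l $ j\<close> is a simple root of P_i, the derivative there is the product of
  the other factors, which is P_j(l_j) without its factor for \<open>i\<close>.\<close>

lemma pderiv_nodal_at:
  assumes "inj (($) l)" "i \<noteq> j"
  shows "poly (pderiv (nodal l i)) (l $ j) = denom l j / (l $ j - l $ i)"
proof -
  have "l $ j - l $ i \<noteq> 0" using assms by (auto simp: inj_eq)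
  moreover have "denom l j = (l $ j - l $ i) * (\<Prod>a\<in>UNIV - {i, j}. l $ j - l $ a)"
    using poly_nodal_split[of j i l "l $ j"] assms(2) by (simp add: denom_def insert_commute)
  ultimately show ?thesis using assms(2) by (simp add: poly_pderiv_nodal_other)
qed

text \<open>Only the factor for \<open>q\<close> feels the shift. The cross-multiplied form holds
  without any genericity condition.\<close>

lemma denom_shift:
  assumes "p \<noteq> q"
  shows "(l $ p - l $ q) * denom (l + axis q \<gamma>) p = (l $ p - l $ q - \<gamma>) * denom l p"
proof -
  have "(\<Prod>a\<in>UNIV - {p, q}. l $ p - (l + axis q \<gamma>) $ a) = (\<Prod>a\<in>UNIV - {p, q}. l $ p - l $ a)"
    by (intro prod.cong) (auto simp: axis_def)
  with assms show ?thesis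
    unfolding denom_def by (subst (1 2) poly_nodal_split[OF assms]) (simp add: axis_def)
qed

lemma denom_shift_self: "denom (l + axis q \<gamma>) q = poly (nodal l q) (l $ q + \<gamma>)"
  unfolding denom_def poly_nodal by (intro prod.cong) (auto simp: axis_def)

lemma shift_at: "(l + axis q (\<gamma> :: complex)) $ p = (if p = q then l $ p + \<gamma> else l $ p)"
  by (auto simp: axis_def)

lemma denom_shift_div:
  assumes "inj (($) l)" "p \<noteq> q"
  shows "denom (l + axis q \<gamma>) p = (l $ p - l $ q - \<gamma>) / (l $ p - l $ q) * denom l p"
  using denom_shift[OF assms(2), of l \<gamma>] assms by (auto simp: inj_eq field_simps)

lemma shift_inj_diff:
  assumes "inj (($) (l + axis q (\<gamma> :: complex)))" "p \<noteq> q"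
  shows "l $ p - l $ q - \<gamma> \<noteq> 0"
proof
  assume "l $ p - l $ q - \<gamma> = 0"
  then have "(l + axis q \<gamma>) $ p = (l + axis q \<gamma>) $ q"
    unfolding shift_at using assms(2) by (simp add: algebra_simps)
  with injD[OF assms(1)] assms(2) show False by blast
qed

text \<open>The first leg only selects the shift. All nodes except the \<open>i\<close>-th stay
  nodes of P_j, where P_j is a multiple of a Kronecker delta, so column \<open>q = i\<close> is the
  only one that needs P_j at the new point l_i + \<open>\<gamma>\<close>.\<close>

lemma Binf_pointwise:
  fixes l :: "'n::{finite,linorder} point"
  assumes l: "inj (($) l)" and s: "\<And>q. inj (($) (l + axis q \<gamma>))"
  shows "Binf \<gamma> l = leg2 (matrix_inv (binf l)) ** leg2_shift \<gamma> binf l"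
proof -
  have "Binf \<gamma> l $ (i, j) $ (p, q) = (leg2 (binv l) ** leg2_shift \<gamma> binf l) $ (i, j) $ (p, q)" for i j p q
  proof -
    have rhs: "(leg2 (binv l) ** leg2_shift \<gamma> binf l) $ (i, j) $ (p, q) =
      (if i = p then poly (nodal l j) ((l + axis i \<gamma>) $ q) / denom (l + axis i \<gamma>) q else 0)"
      unfolding leg_mult_entry binf_denom times_divide_eq_right sum_divide_distrib[symmetric] binv_power ..
    show ?thesis
    proof (cases "q = i")
      case False
      then have "poly (nodal l j) ((l + axis i \<gamma>) $ q) / denom (l + axis i \<gamma>) q =
          (if j = q then (l $ q - l $ i) / (l $ q - l $ i - \<gamma>) else 0)"
        using denom_nz[OF l, of q] by (simp add: shift_at poly_nodal_at denom_shift_div[OF l] del: vector_add_component)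
      with False shift_inj_diff[OF s False] show ?thesis
        unfolding rhs Binf_entry by (auto simp: field_simps)
    next
      case True
      show ?thesis
      proof (cases "j = i")
        case True
        with \<open>q = i\<close> denom_nz[OF s[of i], of i] show ?thesis
          unfolding rhs Binf_entry by (auto simp: shift_at denom_shift_self simp del: vector_add_component)
      next
        case False
        \<comment> \<open>P_j has the factor for \<open>i\<close>, equal to \<open>\<gamma>\<close>
          here, and the shifted denominator has the one for \<open>j\<close>; the remaining product
          is common and cancels.\<close>
        have "poly (nodal l j) (l $ i + \<gamma>) = \<gamma> * (\<Prod>a\<in>UNIV - {i, j}. l $ i + \<gamma> - l $ a)"
          using poly_nodal_split[OF False, of l "l $ i + \<gamma>"] by (simp add: insert_commute)
        moreover have "denom (l + axis i \<gamma>) i = (l $ i + \<gamma> - l $ j) * (\<Prod>a\<in>UNIV - {i, j}. l $ i + \<gamma> - l $ a)"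
          unfolding denom_shift_self by (rule poly_nodal_split) (use False in auto)
        ultimately have "poly (nodal l j) (l $ i + \<gamma>) / denom (l + axis i \<gamma>) i = - (\<gamma> / (l $ j - l $ i - \<gamma>))"
          using denom_nz[OF s[of i], of i] shift_inj_diff[OF s False]
          by (simp add: divide_simps) (simp add: algebra_simps)
        with False \<open>q = i\<close> show ?thesis
          unfolding rhs Binf_entry by (auto simp: shift_at simp del: vector_add_component)
      qed
    qed
  qed
  then show ?thesis by (simp add: vec_eq_iff matrix_inv_binf[OF l])
qed

lemma Ainf_pointwise:
  fixes l :: "'n::{finite,linorder} point"
  assumes l: "inj (($) l)"
  shows "Ainf \<gamma> l = leg1 (matrix_inv (binf l)) ** leg2 (matrix_inv (binf l)) ** Rinf \<gamma> **
                    leg1 (binf l) ** leg2 (binf l)"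
proof -
  have "Ainf \<gamma> l $ (i, j) $ (p, q) =
      ((leg1 (binv l) ** leg2 (binv l)) ** Rinf \<gamma> ** (leg1 (binf l) ** leg2 (binf l))) $ (i, j) $ (p, q)" for i j p q
  proof -
    have rhs: "((leg1 (binv l) ** leg2 (binv l)) ** Rinf \<gamma> ** (leg1 (binf l) ** leg2 (binf l))) $ (i, j) $ (p, q)
      = sandwich (nodal l i) (nodal l j) (Rinf \<gamma> :: 'n matr2) (l $ p) (l $ q) / (denom l p * denom l q)"
      by (rule sandwich_entry) (simp_all add: leg_mult_entry binv_def binf_denom)
    have nz: "denom l p \<noteq> 0" "denom l q \<noteq> 0" using denom_nz[OF l] by auto
    show ?thesis
    proof (cases "p = q")
      case True
      have 1: "sandwich (nodal l i) (nodal l j) (Rinf \<gamma> :: 'n matr2) (l $ p) (l $ p) =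
        (of_bool (i = p \<and> j = p) + (if i \<noteq> j then \<gamma> * (of_bool (j = p) / (l $ p - l $ i) -
           of_bool (i = p) / (l $ p - l $ j)) else 0)) * (denom l p * denom l p)"
        unfolding sandwich_Rinf_diag[OF degree_nodal_less degree_nodal_less] poly_nodal_at
        by (auto simp: pderiv_nodal_at[OF l] algebra_simps)
      have "l $ a - l $ c \<noteq> 0" if "a \<noteq> c" for a c
        using that l by (auto simp: inj_eq)
      then show ?thesis unfolding rhs unfolding True[symmetric] 1 Ainf_entry using nz(1)
        by (auto simp: field_simps)
    next
      case False
      have ne: "l $ p \<noteq> l $ q" using False l by (auto simp: inj_eq)
      show ?thesis unfolding rhs Ainf_entry
          sandwich_Rinf[OF degree_nodal_less degree_nodal_less ne] poly_nodal_at
        using False nz ne by (auto simp: divide_simps) (auto simp: algebra_simps)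
    qed
  qed
  then show ?thesis by (simp add: vec_eq_iff matrix_inv_binf[OF l] matrix_mul_assoc)
qed

text \<open>For p = q the arguments differ by \<open>\<gamma>\<close>, so R only permutes the legs
  and the entry is a Kronecker delta. For p \<noteq> q both arguments are unshifted nodes, and the
  shifts act only through the first polynomial and the denominators.\<close>

lemma Dinf_pointwise:
  fixes l :: "'n::{finite,linorder} point"
  assumes l: "inj (($) l)" and s: "\<And>q. inj (($) (l + axis q \<gamma>))" and \<gamma>: "\<gamma> \<noteq> 0"
  shows "Dinf \<gamma> l = leg1_shift \<gamma> (\<lambda>m. matrix_inv (binf m)) l ** leg2 (matrix_inv (binf l)) ** Rinf \<gamma> **
                   leg1 (binf l) ** leg2_shift \<gamma> binf l"
proof -
  let ?L = "leg1_shift \<gamma> (\<lambda>m. matrix_inv (binf m)) l ** leg2 (binv l)"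
  have "Dinf \<gamma> l $ (i, j) $ (p, q) =
      (?L ** Rinf \<gamma> ** (leg1 (binf l) ** leg2_shift \<gamma> binf l)) $ (i, j) $ (p, q)" for i j p q
  proof -
    \<comment> \<open>The nodes of \<open>?P\<close> depend on the row index \<open>j\<close>. In
      every product evaluated below, the factor \<open>nodal l j\<close>, taken at an unshifted
      node, forces the value of \<open>j\<close>, after which the argument of \<open>?P\<close> is
      one of its own possible nodes.\<close>
    let ?P = "nodal (l + axis j \<gamma>) i" and ?d = "denom l p * denom (l + axis p \<gamma>) q"
    have rhs: "(?L ** Rinf \<gamma> ** (leg1 (binf l) ** leg2_shift \<gamma> binf l)) $ (i, j) $ (p, q)
      = sandwich ?P (nodal l j) (Rinf \<gamma> :: 'n matr2) (l $ p) ((l + axis p \<gamma>) $ q) / ?d"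
      by (rule sandwich_entry)
        (simp_all only: leg_mult_entry matrix_inv_binf[OF s] binf_denom, simp_all add: binv_def)
    have nz: "denom l r \<noteq> 0" "denom (l + axis r \<gamma>) r' \<noteq> 0" for r r'
      using denom_nz[OF l] denom_nz[OF s] by auto
    show ?thesis
    proof (cases "p = q")
      case True
      have ne: "l $ p \<noteq> l $ p + \<gamma>" using \<gamma> by simp
      have "poly ?P (l $ p + \<gamma>) * poly (nodal l j) (l $ p) = of_bool (i = p \<and> j = p) * (denom l p * denom (l + axis p \<gamma>) p)"
        using poly_nodal_at[of "l + axis p \<gamma>" i p] by (auto simp: poly_nodal_at shift_at simp del: vector_add_component)
      then have "sandwich ?P (nodal l j) (Rinf \<gamma> :: 'n matr2) (l $ p) (l $ p + \<gamma>)
          = of_bool (i = p \<and> j = p) * (denom l p * denom (l + axis p \<gamma>) p)"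
        unfolding sandwich_Rinf[OF degree_nodal_less degree_nodal_less ne] using \<gamma> by simp
      with True nz[of p] show ?thesis unfolding rhs Dinf_entry by (auto simp: shift_at simp del: vector_add_component)
    next
      case False
      have ne: "l $ p \<noteq> l $ q" using False l by (auto simp: inj_eq)
      have 1: "poly ?P (l $ p) * poly (nodal l j) (l $ q) = of_bool (i = p \<and> j = q) * (denom (l + axis q \<gamma>) p * denom l q)"
        using poly_nodal_at[of "l + axis q \<gamma>" i p] False by (auto simp: poly_nodal_at shift_at simp del: vector_add_component)
      have 2: "poly ?P (l $ q) * poly (nodal l j) (l $ p) = of_bool (i = q \<and> j = p) * (denom (l + axis p \<gamma>) q * denom l p)"
        using poly_nodal_at[of "l + axis p \<gamma>" i q] False by (auto simp: poly_nodal_at shift_at simp del: vector_add_component)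
      \<comment> \<open>With u = l_p - l_q the shifts multiply the two denominators by (u -
        \<open>\<gamma>\<close>)/u and (u + \<open>\<gamma>\<close>)/u. This quotient turns the
        weight 1 + \<open>\<gamma>\<close>/u of R into the weight 1 - \<open>\<gamma>\<close>/u of
        D.\<close>
      have 3: "denom (l + axis q \<gamma>) p * denom l q / ?d = (l $ p - l $ q - \<gamma>) / (l $ p - l $ q + \<gamma>)"
        using False ne nz(1)[of p] nz(1)[of q] shift_inj_diff[OF s, of q p] shift_inj_diff[OF s, of p q]
        by (simp add: denom_shift_div[OF l] divide_simps) (simp add: algebra_simps)
      have "sandwich ?P (nodal l j) (Rinf \<gamma> :: 'n matr2) (l $ p) (l $ q) / ?d =
          (1 + \<gamma> / (l $ p - l $ q)) * (of_bool (i = p \<and> j = q) * (denom (l + axis q \<gamma>) p * denom l q / ?d)) -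
          \<gamma> / (l $ p - l $ q) * of_bool (i = q \<and> j = p)"
        unfolding sandwich_Rinf[OF degree_nodal_less degree_nodal_less ne] 1 2 using nz
        by (simp add: diff_divide_distrib mult_ac)
      also have "\<dots> = Dinf \<gamma> l $ (i, j) $ (p, q)"
      proof -
        define u where "u = l $ p - l $ q"
        have u: "u \<noteq> 0" "u + \<gamma> \<noteq> 0"
          using ne shift_inj_diff[OF s False[symmetric]] unfolding u_def by (auto simp: algebra_simps)
        then have e1: "(1 + \<gamma> / u) * ((u - \<gamma>) / (u + \<gamma>)) = 1 - \<gamma> / u"
          by (simp add: divide_simps)
        have e2: "\<gamma> / (l $ q - l $ p) = - (\<gamma> / u)"
          using u(1) unfolding u_def by (metis minus_diff_eq minus_divide_right)
        consider "i = p" "j = q" | "i = q" "j = p" | "\<not> (i = p \<and> j = q)" "\<not> (i = q \<and> j = p)"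
          by blast
        then show ?thesis
        proof cases
          case 1
          then show ?thesis unfolding 3 Dinf_entry u_def[symmetric] using False e1 by (simp add: u_def[symmetric])
        next
          case 2
          then show ?thesis unfolding 3 Dinf_entry u_def[symmetric] using False by (simp add: e2)
        next
          case 3
          then have 0: "of_bool (i = p \<and> j = q) = (0 :: complex)" "of_bool (i = q \<and> j = p) = (0 :: complex)"
            "of_bool (p = j \<and> q = i) = (0 :: complex)" "of_bool (p = i \<and> q = j) = (0 :: complex)"
            by auto
          show ?thesis unfolding Dinf_entry 0 by simp
        qed
      qed
      finally show ?thesis unfolding rhs using False by (simp add: shift_at del: vector_add_component)
    qed
  qed
  then show ?thesis by (simp add: vec_eq_iff matrix_inv_binf[OF l] matrix_mul_assoc)
qed

section \<open>Reflection matrices\<close>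

lemma coeff_prod_linear_top:
  fixes g :: "'a \<Rightarrow> complex"
  shows "coeff (\<Prod>a\<in>A. [:- g a, 1:]) (card A) = 1"
  using lead_coeff_prod[of "\<lambda>a. [:- g a, 1:]" A] by (simp add: degree_prod_linear)

lemma coeff_prod_linear_second:
  fixes g :: "'a \<Rightarrow> complex"
  assumes "finite A" "card A = Suc k"
  shows "coeff (\<Prod>a\<in>A. [:- g a, 1:]) k = - (\<Sum>a\<in>A. g a)"
  using assms
proof (induction A arbitrary: k)
  case (insert a F)
  then have k: "k = card F" by simp
  have "coeff (\<Prod>a\<in>insert a F. [:- g a, 1:]) k =
      coeff (pCons 0 (\<Prod>a\<in>F. [:- g a, 1:])) k - g a"
    using insert k coeff_prod_linear_top[of g F] by simp
  also have "coeff (pCons 0 (\<Prod>a\<in>F. [:- g a, 1:])) k = - (\<Sum>a\<in>F. g a)"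
  proof (cases k)
    case 0
    with k insert show ?thesis by simp
  next
    case (Suc m)
    with k have "card F = Suc m" by simp
    from insert.IH[OF this] show ?thesis unfolding Suc by simp
  qed
  finally show ?case using insert by simp
qed simp

lemma sandwich_nunit:
  assumes "1 \<le> p" "p \<le> CARD('n)" "1 \<le> q" "q \<le> CARD('n)"
  shows "(\<Sum>k\<in>UNIV. h (pos k) * (\<Sum>s\<in>UNIV. nunit p q $ (k :: 'n::{finite,linorder}) $ s * g (pos s)))
    = h p * (g q :: complex)"
proof -
  have "(\<Sum>k\<in>(UNIV :: 'n set). h (pos k) * (if pos k = p then g q else 0)) =
      (\<Sum>k=1..CARD('n). h k * (if k = p then g q else 0))"
    by (rule sum_over_pos)
  also have "\<dots> = (\<Sum>k=1..CARD('n). if k = p then h k * g q else 0)"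
    by (intro sum.cong) auto
  also have "\<dots> = h p * g q" using assms by simp
  finally show ?thesis unfolding nunit_apply[OF assms(3,4)] .
qed

text \<open>\<open>Q1\<close> pairs the two top coefficients of P_m, which are 1 and l_m minus the
  sum of all l_a by Vieta, with the powers 1 and l_j. The combination is the first factor of
  \<open>K1\<close>, and the denominator of \<open>binf\<close> supplies its product.\<close>

lemma K1_pointwise:
  fixes l :: "'n::{finite,linorder} point"
  assumes l: "inj (($) l)" and n: "CARD('n) \<ge> 2"
  shows "K1 \<gamma> f l = matrix_inv (binf l) ** Q1 \<gamma> f l ** binf l"
proof -
  let ?n = "CARD('n)"
  have "(binv l ** Q1 \<gamma> f l ** binf l) $ m $ j = K1 \<gamma> f l $ m $ j" for m j
  proof -
    define h where "h k = coeff (nodal l m) (k - 1)" for k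
    define g where "g k = l $ j ^ (k - 1) / denom l j" for k
    have bm: "binv l $ m $ k = h (pos k)" and bj: "binf l $ k $ j = g (pos k)" for k
      by (simp_all add: h_def g_def binv_def binf_denom)
    have "(binv l ** Q1 \<gamma> f l ** binf l) $ m $ j =
      (\<Sum>k\<in>UNIV. h (pos k) * (\<Sum>s\<in>UNIV. Q1 \<gamma> f l $ k $ s * g (pos s)))"
      unfolding matrix_mul_assoc[symmetric] by (simp add: matrix_matrix_mult_def bm bj)
    also have "\<dots> = \<gamma> ^ (?n - 1) *
       (f l * (\<Sum>k\<in>UNIV. h (pos k) * (\<Sum>s\<in>UNIV. nunit ?n 1 $ (k :: 'n) $ s * g (pos s))) +
        (\<Sum>k\<in>UNIV. h (pos k) * (\<Sum>s\<in>UNIV. nunit (?n - 1) 1 $ (k :: 'n) $ s * g (pos s))) +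
        (\<Sum>k\<in>UNIV. h (pos k) * (\<Sum>s\<in>UNIV. nunit ?n 2 $ (k :: 'n) $ s * g (pos s))))"
      unfolding Q1_def smul_def
      by (simp add: sum_distrib_left sum_distrib_right sum.distrib distrib_left distrib_right mult_ac)
    also have "\<dots> = \<gamma> ^ (?n - 1) * (f l * (h ?n * g 1) + h (?n - 1) * g 1 + h ?n * g 2)"
      using n by (subst (1 2 3) sandwich_nunit) auto
    finally have 1: "(binv l ** Q1 \<gamma> f l ** binf l) $ m $ j =
      \<gamma> ^ (?n - 1) * (f l * (h ?n * g 1) + h (?n - 1) * g 1 + h ?n * g 2)" .
    have card: "card (UNIV - {m} :: 'n set) = ?n - 1" by (simp add: card_Diff_subset)
    have hn: "h ?n = 1" 
      unfolding h_def nodal_def card[symmetric] by (rule coeff_prod_linear_top)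
    have "card (UNIV - {m} :: 'n set) = Suc (?n - 1 - 1)" using card n by simp
    then have "h (?n - 1) = - (\<Sum>a\<in>UNIV - {m}. l $ a)"
      unfolding h_def nodal_def by (intro coeff_prod_linear_second) auto
    also have "\<dots> = l $ m - (\<Sum>a\<in>UNIV. l $ a)"
      by (simp add: sum_diff1)
    finally have hn1: "h (?n - 1) = l $ m - (\<Sum>a\<in>UNIV. l $ a)" .
    have "(\<Prod>a\<in>UNIV - {j}. \<gamma> / (l $ j - l $ a)) = \<gamma> ^ (?n - 1) / denom l j"
      by (simp add: prod_dividef denom_def poly_nodal card_Diff_subset)
    then show ?thesis
      unfolding 1 hn hn1 by (simp add: K1_def g_def add_divide_distrib diff_divide_distrib algebra_simps)
  qed
  then show ?thesis by (simp add: vec_eq_iff matrix_inv_binf[OF l])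
qed

text \<open>By the binomial theorem \<open>Q2\<close> translates moment vectors by
  \<open>f l\<close>; its identity part is the term of degree 0 in \<open>f l\<close>.\<close>

lemma Q2_power:
  fixes k :: "'n::{finite,linorder}"
  shows "(\<Sum>s\<in>UNIV. Q2 f l $ k $ s * x ^ (pos s - 1)) = (x + f l) ^ (pos k - 1)"
proof -
  let ?w = "\<lambda>s :: 'n. x ^ (pos s - 1)"
  define w where "w = ?w"
  have add: "(\<Sum>s\<in>UNIV. (M + N :: 'n matr) $ k $ s * w s) =
      (\<Sum>s\<in>UNIV. M $ k $ s * w s) + (\<Sum>s\<in>UNIV. N $ k $ s * w s)" for M N
    by (simp add: distrib_right sum.distrib)
  have sm: "(\<Sum>s\<in>UNIV. (c \<cdot> M) $ k $ s * w s) = c * (\<Sum>s\<in>UNIV. M $ k $ s * w s)" for c and M :: "'n matr"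
    by (simp add: smul_def sum_distrib_left mult_ac)
  have one: "(\<Sum>s\<in>UNIV. (mat 1 :: 'n matr) $ k $ s * w s) = w k"
    by (simp add: mat_def if_distrib[of "\<lambda>t. t * _"] cong: if_cong)
  have nu: "(\<Sum>s\<in>UNIV. (nunit p q :: 'n matr) $ k $ s * w s) = (if pos k = p then x ^ (q - 1) else 0)"
    if "1 \<le> q" "q \<le> CARD('n)" for p q
    unfolding w_def by (rule nunit_apply[OF that, where g = "\<lambda>k. x ^ (k - 1)"])
  have "(\<Sum>s\<in>UNIV. Q2 f l $ k $ s * w s) = w k +
     (\<Sum>i = 1..CARD('n). \<Sum>j = 1..<i. of_nat ((i - 1) choose (i - j)) * f l ^ (i - j) * (if pos k = i then x ^ (j - 1) else 0))"
  proof -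
    have "(\<Sum>s\<in>UNIV. Q2 f l $ k $ s * w s) = w k +
     (\<Sum>i = 1..CARD('n). \<Sum>j = 1..<i. of_nat ((i - 1) choose (i - j)) * f l ^ (i - j) * (\<Sum>s\<in>UNIV. (nunit i j :: 'n matr) $ k $ s * w s))"
      unfolding Q2_def add one sum_matrix_apply sm ..
    also have "\<dots> = w k +
     (\<Sum>i = 1..CARD('n). \<Sum>j = 1..<i. of_nat ((i - 1) choose (i - j)) * f l ^ (i - j) * (if pos k = i then x ^ (j - 1) else 0))"
      by (intro arg_cong2[of _ _ _ _ plus] sum.cong refl arg_cong2[of _ _ _ _ times] nu) auto
    finally show ?thesis .
  qed
  also have "\<dots> = w k +
     (\<Sum>i = 1..CARD('n). if pos k = i then \<Sum>j = 1..<i. of_nat ((i - 1) choose (i - j)) * f l ^ (i - j) * x ^ (j - 1) else 0)"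
    by (intro arg_cong2[of _ _ _ _ plus] sum.cong refl) auto
  also have "\<dots> = w k + (\<Sum>j = 1..<pos k. of_nat ((pos k - 1) choose (pos k - j)) * f l ^ (pos k - j) * x ^ (j - 1))"
    using pos_ge_1[of k] pos_le_CARD[of k] by simp
  also have "\<dots> = (\<Sum>m\<le>pos k - 1. of_nat ((pos k - 1) choose m) * f l ^ m * x ^ (pos k - 1 - m))"
  proof -
    have "(\<Sum>m\<in>{..pos k - 1} - {0}. of_nat ((pos k - 1) choose m) * f l ^ m * x ^ (pos k - 1 - m)) =
       (\<Sum>j = 1..<pos k. of_nat ((pos k - 1) choose (pos k - j)) * f l ^ (pos k - j) * x ^ (j - 1))"
      by (rule sum.reindex_bij_witness[of _ "\<lambda>j. pos k - j" "\<lambda>m. pos k - m"]) auto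
    then show ?thesis by (subst sum.remove[of _ 0]) (auto simp: w_def)
  qed
  also have "\<dots> = (f l + x) ^ (pos k - 1)"
    unfolding binomial_ring ..
  finally show ?thesis by (simp add: w_def add.commute)
qed

text \<open>After the translation the entry is P_i(l_j + f)/P_j(l_j). Replacing P_i by P_j in the
  numerator trades the factor f, from the node l_j, for f - l_i + l_j, from the node l_i; this is
  the prefactor of \<open>K2\<close>. For i = j the hypothesis says f \<noteq> 0, and the prefactor
  is 1.\<close>

lemma K2_pointwise:
  fixes l :: "'n::{finite,linorder} point"
  assumes l: "inj (($) l)" and f: "\<And>i j. f l \<noteq> l $ i - l $ j"
  shows "K2 f l = matrix_inv (binf l) ** Q2 f l ** binf l"
proof -
  have "(binv l ** Q2 f l ** binf l) $ i $ j = K2 f l $ i $ j" for i j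
  proof -
    have lne: "l $ a \<noteq> l $ c" if "a \<noteq> c" for a c using that l by (auto simp: inj_eq)
    have "(binv l ** Q2 f l ** binf l) $ i $ j =
      (\<Sum>k\<in>UNIV. binv l $ i $ k * (\<Sum>s\<in>UNIV. Q2 f l $ k $ s * l $ j ^ (pos s - 1))) / denom l j"
      unfolding matrix_mul_assoc[symmetric]
      by (simp add: matrix_matrix_mult_def binf_denom flip: sum_divide_distrib)
    also have "\<dots> = poly (nodal l i) (l $ j + f l) / denom l j"
      unfolding Q2_power binv_power ..
    also have "\<dots> = f l / (f l - (l $ i - l $ j)) * (poly (nodal l j) (l $ j + f l) / denom l j)"
    proof (cases "i = j")
      case True
      with f[of i j] show ?thesis by simp
    next
      case False
      have "poly (nodal l i) (l $ j + f l) = f l * (\<Prod>a\<in>UNIV - {i, j}. l $ j + f l - l $ a)"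
        using poly_nodal_split[OF False, of l "l $ j + f l"] by simp
      moreover have "poly (nodal l j) (l $ j + f l) =
          (f l - (l $ i - l $ j)) * (\<Prod>a\<in>UNIV - {i, j}. l $ j + f l - l $ a)"
        using poly_nodal_split[OF False[symmetric], of l "l $ j + f l"]
        by (simp add: insert_commute algebra_simps)
      ultimately show ?thesis using f[of i j] by simp
    qed
    also have "poly (nodal l j) (l $ j + f l) / denom l j = (\<Prod>a\<in>UNIV - {j}. 1 + f l / (l $ j - l $ a))"
      unfolding denom_def poly_nodal prod_dividef[symmetric]
    proof (rule prod.cong[OF refl])
      fix a assume "a \<in> UNIV - {j}"
      then have "l $ j - l $ a \<noteq> 0" using lne[of j a] by auto
      then show "(l $ j + f l - l $ a) / (l $ j - l $ a) = 1 + f l / (l $ j - l $ a)"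
        by (simp add: divide_simps)
    qed
    finally show ?thesis by (simp add: K2_def)
  qed
  then show ?thesis by (simp add: vec_eq_iff matrix_inv_binf[OF l])
qed

theorem mainTheorem2:
  fixes \<gamma> :: complex
    and b :: "'n::{finite,linorder} point \<Rightarrow> 'n matr"
    and R :: "'n matr2"
  assumes "CARD('n) \<ge> 2"
    and "\<gamma> \<noteq> 0"
    and b: "b = binf"
    and R: "R = Rinf \<gamma>"
  shows
    "(Binf \<gamma> \<simeq> (\<lambda>l :: 'n point. flip (Cinf \<gamma> l)) \<and>
      Binf \<gamma> \<simeq> (\<lambda>l. leg2 (matrix_inv (b l)) ** leg2_shift \<gamma> b l)) \<and>
     (Ainf \<gamma> \<simeq> (\<lambda>l. leg1 (matrix_inv (b l)) ** leg2 (matrix_inv (b l)) ** R **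
                    leg1 (b l) ** leg2 (b l)) \<and>
      leg12 R ** leg13 R ** leg23 R = leg23 R ** leg13 R ** leg12 R) \<and>
     Dinf \<gamma> \<simeq> (\<lambda>l. leg1_shift \<gamma> (\<lambda>m. matrix_inv (b m)) l ** leg2 (matrix_inv (b l)) ** R **
                   leg1 (b l) ** leg2_shift \<gamma> b l) \<and>
     (\<forall>f :: 'n point \<Rightarrow> complex. meromorphic_fun f \<and> mero_periodic \<gamma> f \<longrightarrow>
        K1 \<gamma> f \<simeq> (\<lambda>l. matrix_inv (b l) ** Q1 \<gamma> f l ** b l) \<and>
        (\<not> f \<simeq> (\<lambda>l. 0) \<longrightarrow> K2 f \<simeq> (\<lambda>l. matrix_inv (b l) ** Q2 f l ** b l)))"
proof -
  define G :: "'n point \<Rightarrow> bool" where "G l \<longleftrightarrow> inj (($) l)" for l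
  \<comment> \<open>B and D contain the twist or its inverse at shifted points, so these must have
    distinct coordinates too; \<open>G\<close> is enough for A and \<open>K1\<close>.\<close>
  define G' where "G' l \<longleftrightarrow> G l \<and> (\<forall>q. G (l + axis q \<gamma>))" for l :: "'n point"
  have "densely (\<lambda>l :: 'n point. i \<noteq> j \<longrightarrow> l $ i - l $ j \<noteq> 0)" for i j
    using densely_coordinates_diff_ne[of i j 0] by (cases "i = j") (simp_all add: densely_True)
  then have "densely (\<lambda>l :: 'n point. \<forall>i j. i \<noteq> j \<longrightarrow> l $ i - l $ j \<noteq> 0)"
    by (intro densely_all)
  then have G: "densely G"
    by (rule densely_mono) (auto simp: G_def inj_def)
  have "densely (\<lambda>l. \<forall>q. G (l + axis q \<gamma>))"
    by (intro densely_all densely_translate G)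
  with G have G': "densely G'"
    unfolding G'_def by (rule densely_conj)
  have B: "Binf \<gamma> \<simeq> (\<lambda>l :: 'n point. flip (Cinf \<gamma> l))"
    unfolding mero_eq_densely by (rule densely_mono[OF G]) (simp add: Cinf_def flip_def vec_eq_iff)
  have B': "Binf \<gamma> \<simeq> (\<lambda>l. leg2 (matrix_inv (b l)) ** leg2_shift \<gamma> b l)"
    unfolding mero_eq_densely b
    by (rule densely_mono[OF G'], rule Binf_pointwise) (simp_all add: G'_def G_def)
  have A: "Ainf \<gamma> \<simeq> (\<lambda>l. leg1 (matrix_inv (b l)) ** leg2 (matrix_inv (b l)) ** R **
                    leg1 (b l) ** leg2 (b l))"
    unfolding mero_eq_densely b R
    by (rule densely_mono[OF G], rule Ainf_pointwise) (simp add: G_def)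
  have D: "Dinf \<gamma> \<simeq> (\<lambda>l. leg1_shift \<gamma> (\<lambda>m. matrix_inv (b m)) l ** leg2 (matrix_inv (b l)) ** R **
                   leg1 (b l) ** leg2_shift \<gamma> b l)"
    unfolding mero_eq_densely b R
    by (rule densely_mono[OF G'], rule Dinf_pointwise) (simp_all add: G'_def G_def assms(2))
  have K: "K1 \<gamma> f \<simeq> (\<lambda>l. matrix_inv (b l) ** Q1 \<gamma> f l ** b l)" for f
    unfolding mero_eq_densely b
    by (rule densely_mono[OF G], rule K1_pointwise) (simp_all add: G_def assms(1))
  have K': "K2 f \<simeq> (\<lambda>l. matrix_inv (b l) ** Q2 f l ** b l)"
    if f: "meromorphic_fun f" "mero_periodic \<gamma> f" "\<not> f \<simeq> (\<lambda>l. 0)" for f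
  proof -
    have "densely (\<lambda>l. \<forall>i j. f l \<noteq> l $ i - l $ j)"
      by (intro densely_all densely_ne_coordinates_diff[OF f(1,2) assms(2) f(3)])
    with G have "densely (\<lambda>l. G l \<and> (\<forall>i j. f l \<noteq> l $ i - l $ j))"
      by (rule densely_conj)
    then show ?thesis
      unfolding mero_eq_densely b
      by (rule densely_mono, intro K2_pointwise) (simp_all add: G_def)
  qed
  from B B' A D K K' Rinf_Yang_Baxter[where 'n = 'n and \<gamma> = \<gamma>] show ?thesis
    unfolding R by blast
qed

end
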